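(* Let $(\mathcal C,\mathbb E,\mathfrak s)$ be an extriangulated category. Let $(\alpha,\beta,1_Z)$, with $\alpha:X\to X'$ and $\beta:Y\to Y'$, be a morphism of $\mathbb E$-triangles from $X\xrightarrow{f}Y\xrightarrow{g}Z\overset{\delta}{\dashrightarrow}$ to $X'\xrightarrow{f'}Y'\xrightarrow{g'}Z\overset{\alpha_*\delta}{\dashrightarrow}$. Consider the morphisms $\left(\begin{smallmatrix}f\\ \alpha\end{smallmatrix}\right):X\to Y\oplus X'$ and $(\beta,-f'):Y\oplus X'\to Y'$ and the $\mathbb E$-extension $(g')^*\delta\in\mathbb E(Y',X)$. (1) The following sequence of functors is exact: $$\mathcal C(Y',-)\xrightarrow{\mathcal C((\beta,-f'),-)}\mathcal C(Y\oplus X',-)\xrightarrow{\mathcal C(\left(\begin{smallmatrix}f\\ \alpha\end{smallmatrix}\right),-)}\mathcal C(X,-)\xrightarrow{((g')^*\delta)^\sharp}\mathbb E(Y',-)\xrightarrow{(\beta,-f')^*}\mathbb E(Y\oplus X',-)\xrightarrow{\left(\begin{smallmatrix}f\\ \alpha\end{smallmatrix}\right)^*}\mathbb E(X,-).$$ (2) If $(\alpha,\beta,1_Z)$ is semi-homotopic, then the following sequence of functors is exact: $$\mathcal C(-,X)\xrightarrow{\mathcal C(-,\left(\begin{smallmatrix}f\\ \alpha\end{smallmatrix}\right))}\mathcal C(-,Y\oplus X')\xrightarrow{\mathcal C(-,(\beta,-f'))}\mathcal C(-,Y')\xrightarrow{((g')^*\delta)_\sharp}\mathbb E(-,X)\xrightarrow{\left(\begin{smallmatrix}f\\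 \alpha\end{smallmatrix}\right)_*}\mathbb E(-,Y\oplus X')\xrightarrow{(\beta,-f')_*}\mathbb E(-,Y').$$ (3) If $\mathcal C$ is a $\mathrm{Hom}$-finite $k$-linear category, where $k$ is a field, then $(\alpha,\beta,1_Z)$ is semi-homotopic.
   Context: Extriangulated categories (Nakaoka–Palu). Let $\mathcal C$ be an additive category and $\mathbb E:\mathcal C^{\mathrm{op}}\times\mathcal C\to\mathbf{Ab}$ an additive bifunctor. An element $\delta\in\mathbb E(Z,X)$ is an $\mathbb E$-extension; write $f_*=\mathbb E(-,f)$ and $g^*=\mathbb E(g,-)$. Two sequences $X\to Y\to Z$ and $X\to Y'\to Z$ are equivalent if there is an isomorphism $Y\cong Y'$ compatible with the maps from $X$ and to $Z$. An additive realization $\mathfrak s$ assigns to each $\delta\in\mathbb E(Z,X)$ an equivalence class $\mathfrak s(\delta)=[X\xrightarrow{f}Y\xrightarrow{g}Z]$ such that: (i) if $\delta\in\mathbb E(Z,X)$, $\delta'\in\mathbb E(Z',X')$, $\alpha:X\to X'$, $\gamma:Z\to Z'$ satisfy $\alpha_*\delta=\gamma^*\delta'$, then for any representatives $X\xrightarrow{f}Y\xrightarrow{g}Z$ of $\mathfrak s(\delta)$ and $X'\xrightarrow{f'}Y'\xrightarrow{g'}Z'$ of $\mathfrak s(\delta')$ there is $\beta:Y\to Y'$ with $\beta f=f'\alpha$, $g'\beta=\gamma g$; (ii) $0\in\mathbb E(Z,X)$ is realized by the split sequence $X\to X\oplus Z\to Z$; (iii) $\mathfrak s(\delta\oplus\delta')=\mathfrak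 s(\delta)\oplus\mathfrak s(\delta')$. If $\mathfrak s(\delta)=[X\xrightarrow{f}Y\xrightarrow{g}Z]$, one writes $X\xrightarrow{f}Y\xrightarrow{g}Z\overset{\delta}{\dashrightarrow}$ and calls it an $\mathbb E$-triangle, $f$ an $\mathbb E$-inflation, $g$ an $\mathbb E$-deflation. A morphism of $\mathbb E$-triangles from this one to $X'\xrightarrow{f'}Y'\xrightarrow{g'}Z'\overset{\delta'}{\dashrightarrow}$ is a triple $(\alpha,\beta,\gamma)$ with $\beta f=f'\alpha$, $g'\beta=\gamma g$, $\alpha_*\delta=\gamma^*\delta'$. $(\mathcal C,\mathbb E,\mathfrak s)$ is an extriangulated category if moreover: (ET3) for two such $\mathbb E$-triangles and $\alpha,\beta$ with $\beta f=f'\alpha$ there is $\gamma$ making $(\alpha,\beta,\gamma)$ a morphism of $\mathbb E$-triangles; (ET3$^{\mathrm{op}}$) given $\beta,\gamma$ with $\gamma g=g'\beta$ there is $\alpha$ making $(\alpha,\beta,\gamma)$ a morphism of $\mathbb E$-triangles; (ET4) given $\mathbb E$-triangles $A\xrightarrow{f}B\xrightarrow{g}D\overset{\delta}{\dashrightarrow}$ and $B\xrightarrow{u}C\xrightarrow{v}E\overset{\varepsilon}{\dashrightarrow}$ there are $\mathbb E$-triangles $A\xrightarrow{m}C\xrightarrow{h}F\overset{\theta}{\dashrightarrow}$ and $D\xrightarrow{w}F\xrightarrow{q}E\overset{\eta}{\dashrightarrow}$ with $m=uf$, $wg=hu$, $v=qh$, $w^*\theta=\delta$, $g_*\varepsilon=\eta$,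 $f_*\theta=q^*\varepsilon$; (ET4$^{\mathrm{op}}$) conversely, given the latter two $\mathbb E$-triangles there are $\mathbb E$-triangles of the former form satisfying the same six relations. For $\eta\in\mathbb E(Y',X)$: $\eta^\sharp:\mathcal C(X,-)\to\mathbb E(Y',-)$ sends $\psi:X\to T$ to $\psi_*\eta$, and $\eta_\sharp:\mathcal C(-,Y')\to\mathbb E(-,X)$ sends $\varphi:T\to Y'$ to $\varphi^*\eta$. Exactness of a sequence of six functors means exactness at each of the four inner terms, evaluated at every object. The morphism $(\alpha,\beta,1_Z)$ is semi-homotopic if there is some $\eta\in\mathbb E(Y',X)$ such that $X\xrightarrow{\left(\begin{smallmatrix}f\\ \alpha\end{smallmatrix}\right)}Y\oplus X'\xrightarrow{(\beta,-f')}Y'\overset{\eta}{\dashrightarrow}$ is an $\mathbb E$-triangle. A category is $k$-linear if its Hom sets are $k$-vector spaces with $k$-bilinear composition, and $\mathrm{Hom}$-finite if all these vector spaces are finite-dimensional. *)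

theory Defs
  imports "HOL-Algebra.AbelCoset" "Jordan_Normal_Form.Missing_VectorSpace"
begin

text \<open>
  Abelian groups are \<open>ring\<close> records satisfying \<open>abelian_group\<close>, whose multiplicative fields are
  irrelevant. Composition and the action of morphisms on extensions are not indexed by objects;
  the sets \<open>Hom C X Y\<close> (and the groups of extensions) need not be disjoint, but may be taken to be,
  so every category with the structure below can be presented in this form.

  \<open>X \<boxplus>\<^bsub>C\<^esub> Y\<close> is the biproduct with injections \<open>in1\<close>, \<open>in2\<close> and projections \<open>pr1\<close>, \<open>pr2\<close>. It is part
  of the data, so that theorems hold for every choice of biproducts.
\<close>

record ('o, 'm) additive_cat =
  Obj :: "'o set"
  Hom :: "'o \<Rightarrow> 'o \<Rightarrow> 'm ring"
  Ident :: "'o \<Rightarrow> 'm"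
  Comp :: "'m \<Rightarrow> 'm \<Rightarrow> 'm"  (infixr \<open>\<cdot>\<index>\<close> 70)
  Bip :: "'o \<Rightarrow> 'o \<Rightarrow> 'o"  (infixr \<open>\<boxplus>\<index>\<close> 65)
  in1 :: "'o \<Rightarrow> 'o \<Rightarrow> 'm"
  in2 :: "'o \<Rightarrow> 'o \<Rightarrow> 'm"
  pr1 :: "'o \<Rightarrow> 'o \<Rightarrow> 'm"
  pr2 :: "'o \<Rightarrow> 'o \<Rightarrow> 'm"

abbreviation is_mor :: "('o, 'm, 'z) additive_cat_scheme \<Rightarrow> 'm \<Rightarrow> 'o \<Rightarrow> 'o \<Rightarrow> bool" where
  "is_mor C f X Y \<equiv> f \<in> carrier (Hom C X Y)"

locale preadditive_category =
  fixes C :: "('o, 'm, 'z) additive_cat_scheme" (structure)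
  assumes Ident_mor: "X \<in> Obj C \<Longrightarrow> is_mor C (Ident C X) X X"
    and Comp_mor:
      "\<lbrakk>X \<in> Obj C; Y \<in> Obj C; Z \<in> Obj C; is_mor C f X Y; is_mor C g Y Z\<rbrakk> \<Longrightarrow> is_mor C (g \<cdot> f) X Z"
    and Comp_Ident: "\<lbrakk>X \<in> Obj C; Y \<in> Obj C; is_mor C f X Y\<rbrakk> \<Longrightarrow> f \<cdot> Ident C X = f"
    and Ident_Comp: "\<lbrakk>X \<in> Obj C; Y \<in> Obj C; is_mor C f X Y\<rbrakk> \<Longrightarrow> Ident C Y \<cdot> f = f"
    and Comp_assoc:
      "\<lbrakk>W \<in> Obj C; X \<in> Obj C; Y \<in> Obj C; Z \<in> Obj C;
        is_mor C f W X; is_mor C g X Y; is_mor C h Y Z\<rbrakk> \<Longrightarrow> (h \<cdot> g) \<cdot> f = h \<cdot> (g \<cdot> f)"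
    and Hom_abelian_group: "\<lbrakk>X \<in> Obj C; Y \<in> Obj C\<rbrakk> \<Longrightarrow> abelian_group (Hom C X Y)"
    and Comp_add_right:
      "\<lbrakk>X \<in> Obj C; Y \<in> Obj C; Z \<in> Obj C; is_mor C f X Y; is_mor C f' X Y; is_mor C g Y Z\<rbrakk>
        \<Longrightarrow> g \<cdot> (f \<oplus>\<^bsub>Hom C X Y\<^esub> f') = (g \<cdot> f) \<oplus>\<^bsub>Hom C X Z\<^esub> (g \<cdot> f')"
    and Comp_add_left:
      "\<lbrakk>X \<in> Obj C; Y \<in> Obj C; Z \<in> Obj C; is_mor C f X Y; is_mor C g Y Z; is_mor C g' Y Z\<rbrakk>
        \<Longrightarrow> (g \<oplus>\<^bsub>Hom C Y Z\<^esub> g') \<cdot> f = (g \<cdot> f) \<oplus>\<^bsub>Hom C X Z\<^esub> (g' \<cdot> f)"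

definition is_zero_object :: "('o, 'm, 'z) additive_cat_scheme \<Rightarrow> 'o \<Rightarrow> bool" where
  "is_zero_object C N \<longleftrightarrow> N \<in> Obj C \<and> (\<forall>X\<in>Obj C. (\<exists>!f. is_mor C f X N) \<and> (\<exists>!f. is_mor C f N X))"

locale additive_category = preadditive_category +
  assumes zero_object: "\<exists>N. is_zero_object C N"
    and Bip_Obj: "\<lbrakk>X \<in> Obj C; Y \<in> Obj C\<rbrakk> \<Longrightarrow> X \<boxplus> Y \<in> Obj C"
    and in1_mor: "\<lbrakk>X \<in> Obj C; Y \<in> Obj C\<rbrakk> \<Longrightarrow> is_mor C (in1 C X Y) X (X \<boxplus> Y)"
    and in2_mor: "\<lbrakk>X \<in> Obj C; Y \<in> Obj C\<rbrakk> \<Longrightarrow> is_mor C (in2 C X Y) Y (X \<boxplus> Y)"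
    and pr1_mor: "\<lbrakk>X \<in> Obj C; Y \<in> Obj C\<rbrakk> \<Longrightarrow> is_mor C (pr1 C X Y) (X \<boxplus> Y) X"
    and pr2_mor: "\<lbrakk>X \<in> Obj C; Y \<in> Obj C\<rbrakk> \<Longrightarrow> is_mor C (pr2 C X Y) (X \<boxplus> Y) Y"
    and pr1_in1: "\<lbrakk>X \<in> Obj C; Y \<in> Obj C\<rbrakk> \<Longrightarrow> pr1 C X Y \<cdot> in1 C X Y = Ident C X"
    and pr2_in2: "\<lbrakk>X \<in> Obj C; Y \<in> Obj C\<rbrakk> \<Longrightarrow> pr2 C X Y \<cdot> in2 C X Y = Ident C Y"
    and pr1_in2: "\<lbrakk>X \<in> Obj C; Y \<in> Obj C\<rbrakk> \<Longrightarrow> pr1 C X Y \<cdot> in2 C X Y = \<zero>\<^bsub>Hom C Y X\<^esub>"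
    and pr2_in1: "\<lbrakk>X \<in> Obj C; Y \<in> Obj C\<rbrakk> \<Longrightarrow> pr2 C X Y \<cdot> in1 C X Y = \<zero>\<^bsub>Hom C X Y\<^esub>"
    and in_pr_sum:
      "\<lbrakk>X \<in> Obj C; Y \<in> Obj C\<rbrakk> \<Longrightarrow>
        (in1 C X Y \<cdot> pr1 C X Y) \<oplus>\<^bsub>Hom C (X \<boxplus> Y) (X \<boxplus> Y)\<^esub> (in2 C X Y \<cdot> pr2 C X Y) = Ident C (X \<boxplus> Y)"

text \<open>The column \<open>(a, b)\<^sup>T : T \<rightarrow> X \<boxplus> Y\<close>, the row \<open>(a, b) : X \<boxplus> Y \<rightarrow> T\<close>, and the diagonal map
  \<open>X \<boxplus> X' \<rightarrow> Y \<boxplus> Y'\<close>.\<close>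

definition col :: "('o, 'm, 'z) additive_cat_scheme \<Rightarrow> 'o \<Rightarrow> 'o \<Rightarrow> 'o \<Rightarrow> 'm \<Rightarrow> 'm \<Rightarrow> 'm" where
  "col C T X Y a b =
     (in1 C X Y \<cdot>\<^bsub>C\<^esub> a) \<oplus>\<^bsub>Hom C T (X \<boxplus>\<^bsub>C\<^esub> Y)\<^esub> (in2 C X Y \<cdot>\<^bsub>C\<^esub> b)"

definition row :: "('o, 'm, 'z) additive_cat_scheme \<Rightarrow> 'o \<Rightarrow> 'o \<Rightarrow> 'o \<Rightarrow> 'm \<Rightarrow> 'm \<Rightarrow> 'm" where
  "row C X Y T a b =
     (a \<cdot>\<^bsub>C\<^esub> pr1 C X Y) \<oplus>\<^bsub>Hom C (X \<boxplus>\<^bsub>C\<^esub> Y) T\<^esub> (b \<cdot>\<^bsub>C\<^esub> pr2 C X Y)"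

definition diag ::
  "('o, 'm, 'z) additive_cat_scheme \<Rightarrow> 'o \<Rightarrow> 'o \<Rightarrow> 'o \<Rightarrow> 'o \<Rightarrow> 'm \<Rightarrow> 'm \<Rightarrow> 'm" where
  "diag C X X' Y Y' f f' =
     (in1 C Y Y' \<cdot>\<^bsub>C\<^esub> f \<cdot>\<^bsub>C\<^esub> pr1 C X X')
       \<oplus>\<^bsub>Hom C (X \<boxplus>\<^bsub>C\<^esub> X') (Y \<boxplus>\<^bsub>C\<^esub> Y')\<^esub> (in2 C Y Y' \<cdot>\<^bsub>C\<^esub> f' \<cdot>\<^bsub>C\<^esub> pr2 C X X')"

text \<open>
  \<open>Ext C Z X\<close> is the group \<open>E(Z, X)\<close>, contravariant in \<open>Z\<close>, and \<open>Emap C g f\<close> is the action \<open>E(g, f)\<close>.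
  \<open>Realize C Z X \<delta>\<close> is the equivalence class realizing \<open>\<delta> \<in> E(Z, X)\<close>; a triple \<open>(f, Y, g)\<close> in it stands
  for the sequence \<open>X \<rightarrow> Y \<rightarrow> Z\<close> with maps \<open>f\<close> and \<open>g\<close>.
\<close>

record ('o, 'm, 'e) extri_cat = "('o, 'm) additive_cat" +
  Ext :: "'o \<Rightarrow> 'o \<Rightarrow> 'e ring"
  Emap :: "'m \<Rightarrow> 'm \<Rightarrow> 'e \<Rightarrow> 'e"
  Realize :: "'o \<Rightarrow> 'o \<Rightarrow> 'e \<Rightarrow> ('m \<times> 'o \<times> 'm) set"

locale additive_bifunctor = additive_category C
  for C :: "('o, 'm, 'e, 'z) extri_cat_scheme" (structure) +
  assumes Ext_abelian_group: "\<lbrakk>Z \<in> Obj C; X \<in> Obj C\<rbrakk> \<Longrightarrow> abelian_group (Ext C Z X)"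
    and Emap_hom:
      "\<lbrakk>Z \<in> Obj C; Z' \<in> Obj C; X \<in> Obj C; X' \<in> Obj C; is_mor C g Z' Z; is_mor C f X X'\<rbrakk>
        \<Longrightarrow> abelian_group_hom (Ext C Z X) (Ext C Z' X') (Emap C g f)"
    and Emap_Ident:
      "\<lbrakk>Z \<in> Obj C; X \<in> Obj C; \<delta> \<in> carrier (Ext C Z X)\<rbrakk> \<Longrightarrow> Emap C (Ident C Z) (Ident C X) \<delta> = \<delta>"
    and Emap_Comp:
      "\<lbrakk>Z \<in> Obj C; Z' \<in> Obj C; Z'' \<in> Obj C; X \<in> Obj C; X' \<in> Obj C; X'' \<in> Obj C;
        is_mor C g Z' Z; is_mor C g' Z'' Z'; is_mor C f X X'; is_mor C f' X' X'';
        \<delta> \<in> carrier (Ext C Z X)\<rbrakk>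
        \<Longrightarrow> Emap C (g \<cdot> g') (f' \<cdot> f) \<delta> = Emap C g' f' (Emap C g f \<delta>)"
    and Emap_add_left:
      "\<lbrakk>Z \<in> Obj C; Z' \<in> Obj C; X \<in> Obj C; X' \<in> Obj C;
        is_mor C g Z' Z; is_mor C g' Z' Z; is_mor C f X X'; \<delta> \<in> carrier (Ext C Z X)\<rbrakk>
        \<Longrightarrow> Emap C (g \<oplus>\<^bsub>Hom C Z' Z\<^esub> g') f \<delta> = Emap C g f \<delta> \<oplus>\<^bsub>Ext C Z' X'\<^esub> Emap C g' f \<delta>"
    and Emap_add_right:
      "\<lbrakk>Z \<in> Obj C; Z' \<in> Obj C; X \<in> Obj C; X' \<in> Obj C;
        is_mor C g Z' Z; is_mor C f X X'; is_mor C f' X X'; \<delta> \<in> carrier (Ext C Z X)\<rbrakk>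
        \<Longrightarrow> Emap C g (f \<oplus>\<^bsub>Hom C X X'\<^esub> f') \<delta> = Emap C g f \<delta> \<oplus>\<^bsub>Ext C Z' X'\<^esub> Emap C g f' \<delta>"

text \<open>\<open>f\<^sub>*\<close> on \<open>E(Z, -)\<close> and \<open>g\<^sup>*\<close> on \<open>E(-, X)\<close>.\<close>

definition push :: "('o, 'm, 'e, 'z) extri_cat_scheme \<Rightarrow> 'o \<Rightarrow> 'm \<Rightarrow> 'e \<Rightarrow> 'e" where
  "push C Z f \<delta> = Emap C (Ident C Z) f \<delta>"

definition pull :: "('o, 'm, 'e, 'z) extri_cat_scheme \<Rightarrow> 'o \<Rightarrow> 'm \<Rightarrow> 'e \<Rightarrow> 'e" where
  "pull C X g \<delta> = Emap C g (Ident C X) \<delta>"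

text \<open>The element of \<open>E(Z \<boxplus> Z', X \<boxplus> X')\<close> corresponding to \<open>(\<delta>, 0, 0, \<delta>')\<close> in
  \<open>E(Z, X) \<oplus> E(Z, X') \<oplus> E(Z', X) \<oplus> E(Z', X')\<close>.\<close>

definition ext_sum ::
  "('o, 'm, 'e, 'z) extri_cat_scheme \<Rightarrow> 'o \<Rightarrow> 'o \<Rightarrow> 'o \<Rightarrow> 'o \<Rightarrow> 'e \<Rightarrow> 'e \<Rightarrow> 'e" where
  "ext_sum C Z Z' X X' \<delta> \<delta>' =
     Emap C (pr1 C Z Z') (in1 C X X') \<delta>
       \<oplus>\<^bsub>Ext C (Z \<boxplus>\<^bsub>C\<^esub> Z') (X \<boxplus>\<^bsub>C\<^esub> X')\<^esub> Emap C (pr2 C Z Z') (in2 C X X') \<delta>'"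

definition sequences :: "('o, 'm, 'z) additive_cat_scheme \<Rightarrow> 'o \<Rightarrow> 'o \<Rightarrow> ('m \<times> 'o \<times> 'm) set" where
  "sequences C X Z = {(f, Y, g). Y \<in> Obj C \<and> is_mor C f X Y \<and> is_mor C g Y Z}"

definition is_iso :: "('o, 'm, 'z) additive_cat_scheme \<Rightarrow> 'm \<Rightarrow> 'o \<Rightarrow> 'o \<Rightarrow> bool" where
  "is_iso C \<phi> Y Y' \<longleftrightarrow> is_mor C \<phi> Y Y' \<and>
     (\<exists>\<psi>. is_mor C \<psi> Y' Y \<and> \<psi> \<cdot>\<^bsub>C\<^esub> \<phi> = Ident C Y \<and> \<phi> \<cdot>\<^bsub>C\<^esub> \<psi> = Ident C Y')"

definition seq_equiv ::
  "('o, 'm, 'z) additive_cat_scheme \<Rightarrow> 'o \<Rightarrow> 'o \<Rightarrow> (('m \<times> 'o \<times> 'm) \<times> ('m \<times> 'o \<times> 'm)) set" where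
  "seq_equiv C X Z = {((f, Y, g), (f', Y', g')).
     (f, Y, g) \<in> sequences C X Z \<and> (f', Y', g') \<in> sequences C X Z \<and>
     (\<exists>\<phi>. is_iso C \<phi> Y Y' \<and> \<phi> \<cdot>\<^bsub>C\<^esub> f = f' \<and> g' \<cdot>\<^bsub>C\<^esub> \<phi> = g)}"

definition seq_class ::
  "('o, 'm, 'z) additive_cat_scheme \<Rightarrow> 'o \<Rightarrow> 'o \<Rightarrow> 'm \<Rightarrow> 'o \<Rightarrow> 'm \<Rightarrow> ('m \<times> 'o \<times> 'm) set" where
  "seq_class C X Z f Y g = seq_equiv C X Z `` {(f, Y, g)}"

definition E_triangle ::
  "('o, 'm, 'e, 'z) extri_cat_scheme \<Rightarrow> 'o \<Rightarrow> 'm \<Rightarrow> 'o \<Rightarrow> 'm \<Rightarrow> 'o \<Rightarrow> 'e \<Rightarrow> bool" where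
  "E_triangle C X f Y g Z \<delta> \<longleftrightarrow>
     X \<in> Obj C \<and> Z \<in> Obj C \<and> (f, Y, g) \<in> sequences C X Z \<and>
     \<delta> \<in> carrier (Ext C Z X) \<and> Realize C Z X \<delta> = seq_class C X Z f Y g"

locale additive_realization = additive_bifunctor +
  assumes Realize_class:
      "\<lbrakk>Z \<in> Obj C; X \<in> Obj C; \<delta> \<in> carrier (Ext C Z X)\<rbrakk>
        \<Longrightarrow> Realize C Z X \<delta> \<in> sequences C X Z // seq_equiv C X Z"
    and Realize_morphism:
      "\<lbrakk>E_triangle C X f Y g Z \<delta>; E_triangle C X' f' Y' g' Z' \<delta>';
        is_mor C \<alpha> X X'; is_mor C \<gamma> Z Z'; push C Z \<alpha> \<delta> = pull C X' \<gamma> \<delta>'\<rbrakk>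
        \<Longrightarrow> \<exists>\<beta>. is_mor C \<beta> Y Y' \<and> \<beta> \<cdot> f = f' \<cdot> \<alpha> \<and> g' \<cdot> \<beta> = \<gamma> \<cdot> g"
    and Realize_zero:
      "\<lbrakk>Z \<in> Obj C; X \<in> Obj C\<rbrakk>
        \<Longrightarrow> Realize C Z X \<zero>\<^bsub>Ext C Z X\<^esub> = seq_class C X Z (in1 C X Z) (X \<boxplus> Z) (pr2 C X Z)"
    and Realize_sum:
      "\<lbrakk>E_triangle C X f Y g Z \<delta>; E_triangle C X' f' Y' g' Z' \<delta>'\<rbrakk>
        \<Longrightarrow> Realize C (Z \<boxplus> Z') (X \<boxplus> X') (ext_sum C Z Z' X X' \<delta> \<delta>') =
            seq_class C (X \<boxplus> X') (Z \<boxplus> Z') (diag C X X' Y Y' f f') (Y \<boxplus> Y') (diag C Y Y' Z Z' g g')"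

definition E_triangle_morphism ::
  "('o, 'm, 'e, 'z) extri_cat_scheme \<Rightarrow> 'o \<Rightarrow> 'm \<Rightarrow> 'o \<Rightarrow> 'm \<Rightarrow> 'o \<Rightarrow> 'e
     \<Rightarrow> 'o \<Rightarrow> 'm \<Rightarrow> 'o \<Rightarrow> 'm \<Rightarrow> 'o \<Rightarrow> 'e \<Rightarrow> 'm \<Rightarrow> 'm \<Rightarrow> 'm \<Rightarrow> bool" where
  "E_triangle_morphism C X f Y g Z \<delta> X' f' Y' g' Z' \<delta>' \<alpha> \<beta> \<gamma> \<longleftrightarrow>
     E_triangle C X f Y g Z \<delta> \<and> E_triangle C X' f' Y' g' Z' \<delta>' \<and>
     is_mor C \<alpha> X X' \<and> is_mor C \<beta> Y Y' \<and> is_mor C \<gamma> Z Z' \<and>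
     \<beta> \<cdot>\<^bsub>C\<^esub> f = f' \<cdot>\<^bsub>C\<^esub> \<alpha> \<and> g' \<cdot>\<^bsub>C\<^esub> \<beta> = \<gamma> \<cdot>\<^bsub>C\<^esub> g \<and> push C Z \<alpha> \<delta> = pull C X' \<gamma> \<delta>'"

text \<open>The six relations shared by (ET4) and its dual, for the sequences
  \<open>A \<rightarrow> B \<rightarrow> D\<close> (maps \<open>f\<close>, \<open>g\<close>, extension \<open>\<delta>\<close>), \<open>B \<rightarrow> M \<rightarrow> E\<close> (\<open>u\<close>, \<open>v\<close>, \<open>\<epsilon>\<close>),
  \<open>A \<rightarrow> M \<rightarrow> F\<close> (\<open>m\<close>, \<open>h\<close>, \<open>\<theta>\<close>) and \<open>D \<rightarrow> F \<rightarrow> E\<close> (\<open>w\<close>, \<open>q\<close>, \<open>\<eta>\<close>).\<close>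

definition ET4_relations ::
  "('o, 'm, 'e, 'z) extri_cat_scheme \<Rightarrow> 'o \<Rightarrow> 'o \<Rightarrow> 'o \<Rightarrow> 'o
     \<Rightarrow> 'm \<Rightarrow> 'm \<Rightarrow> 'e \<Rightarrow> 'm \<Rightarrow> 'm \<Rightarrow> 'e \<Rightarrow> 'm \<Rightarrow> 'm \<Rightarrow> 'e \<Rightarrow> 'm \<Rightarrow> 'm \<Rightarrow> 'e \<Rightarrow> bool" where
  "ET4_relations C A B E F f g \<delta> u v \<epsilon> m h \<theta> w q \<eta> \<longleftrightarrow>
     m = u \<cdot>\<^bsub>C\<^esub> f \<and> w \<cdot>\<^bsub>C\<^esub> g = h \<cdot>\<^bsub>C\<^esub> u \<and> v = q \<cdot>\<^bsub>C\<^esub> h \<and>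
     pull C A w \<theta> = \<delta> \<and> push C E g \<epsilon> = \<eta> \<and> push C F f \<theta> = pull C B q \<epsilon>"

locale extriangulated_category = additive_realization +
  assumes ET3:
      "\<lbrakk>E_triangle C X f Y g Z \<delta>; E_triangle C X' f' Y' g' Z' \<delta>';
        is_mor C \<alpha> X X'; is_mor C \<beta> Y Y'; \<beta> \<cdot> f = f' \<cdot> \<alpha>\<rbrakk>
        \<Longrightarrow> \<exists>\<gamma>. E_triangle_morphism C X f Y g Z \<delta> X' f' Y' g' Z' \<delta>' \<alpha> \<beta> \<gamma>"
    and ET3_op:
      "\<lbrakk>E_triangle C X f Y g Z \<delta>; E_triangle C X' f' Y' g' Z' \<delta>';
        is_mor C \<beta> Y Y'; is_mor C \<gamma> Z Z'; \<gamma> \<cdot> g = g' \<cdot> \<beta>\<rbrakk>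
        \<Longrightarrow> \<exists>\<alpha>. E_triangle_morphism C X f Y g Z \<delta> X' f' Y' g' Z' \<delta>' \<alpha> \<beta> \<gamma>"
    and ET4:
      "\<lbrakk>E_triangle C A f B g D \<delta>; E_triangle C B u M v E \<epsilon>\<rbrakk>
        \<Longrightarrow> \<exists>F m h \<theta> w q \<eta>. E_triangle C A m M h F \<theta> \<and> E_triangle C D w F q E \<eta> \<and>
              ET4_relations C A B E F f g \<delta> u v \<epsilon> m h \<theta> w q \<eta>"
    and ET4_op:
      "\<lbrakk>E_triangle C A m M h F \<theta>; E_triangle C D w F q E \<eta>\<rbrakk>
        \<Longrightarrow> \<exists>B f g \<delta> u v \<epsilon>. E_triangle C A f B g D \<delta> \<and> E_triangle C B u M v E \<epsilon> \<and>
              ET4_relations C A B E F f g \<delta> u v \<epsilon> m h \<theta> w q \<eta>"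

text \<open>Semi-homotopy of a morphism \<open>(\<alpha>, \<beta>, 1)\<close> from \<open>X \<rightarrow> Y \<rightarrow> Z\<close> to \<open>X' \<rightarrow> Y' \<rightarrow> Z\<close>, whose first maps
  are \<open>f\<close> and \<open>f'\<close>; it does not involve the remaining data of the two triangles.\<close>

definition semi_homotopic ::
  "('o, 'm, 'e, 'z) extri_cat_scheme \<Rightarrow> 'o \<Rightarrow> 'm \<Rightarrow> 'o \<Rightarrow> 'o \<Rightarrow> 'm \<Rightarrow> 'o \<Rightarrow> 'm \<Rightarrow> 'm \<Rightarrow> bool" where
  "semi_homotopic C X f Y X' f' Y' \<alpha> \<beta> \<longleftrightarrow>
     (\<exists>\<eta>\<in>carrier (Ext C Y' X).
        E_triangle C X (col C X Y X' f \<alpha>) (Y \<boxplus>\<^bsub>C\<^esub> X')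
          (row C Y X' Y' \<beta> (\<ominus>\<^bsub>Hom C X' Y'\<^esub> f')) Y' \<eta>)"

definition exact_at ::
  "'a ring \<Rightarrow> ('a \<Rightarrow> 'b) \<Rightarrow> 'b ring \<Rightarrow> ('b \<Rightarrow> 'c) \<Rightarrow> 'c ring \<Rightarrow> bool" where
  "exact_at A \<phi> B \<psi> D \<longleftrightarrow>
     abelian_group_hom A B \<phi> \<and> abelian_group_hom B D \<psi> \<and> \<phi> ` carrier A = a_kernel B D \<psi>"

definition exact_six ::
  "'a ring \<Rightarrow> ('a \<Rightarrow> 'a) \<Rightarrow> 'a ring \<Rightarrow> ('a \<Rightarrow> 'a) \<Rightarrow> 'a ring \<Rightarrow> ('a \<Rightarrow> 'b)
     \<Rightarrow> 'b ring \<Rightarrow> ('b \<Rightarrow> 'b) \<Rightarrow> 'b ring \<Rightarrow> ('b \<Rightarrow> 'b) \<Rightarrow> 'b ring \<Rightarrow> bool" where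
  "exact_six A1 \<phi>1 A2 \<phi>2 A3 \<phi>3 A4 \<phi>4 A5 \<phi>5 A6 \<longleftrightarrow>
     exact_at A1 \<phi>1 A2 \<phi>2 A3 \<and> exact_at A2 \<phi>2 A3 \<phi>3 A4 \<and>
     exact_at A3 \<phi>3 A4 \<phi>4 A5 \<and> exact_at A4 \<phi>4 A5 \<phi>5 A6"

text \<open>\<open>Hom C X Y\<close> with a scalar multiplication. Taking the existing addition as that of the vector
  space is no restriction: an additive category has only one enrichment in abelian groups.\<close>

definition hom_space ::
  "('o, 'm, 'z) additive_cat_scheme \<Rightarrow> ('k \<Rightarrow> 'm \<Rightarrow> 'm) \<Rightarrow> 'o \<Rightarrow> 'o \<Rightarrow> ('k, 'm) module" where
  "hom_space C scal X Y = ring.extend (Hom C X Y) \<lparr>smult = scal\<rparr>"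

locale linear_category = preadditive_category C + field K
  for C :: "('o, 'm, 'z) additive_cat_scheme" (structure) and K :: "'k ring" +
  fixes scal :: "'k \<Rightarrow> 'm \<Rightarrow> 'm"
  assumes hom_vectorspace:
      "\<lbrakk>X \<in> Obj C; Y \<in> Obj C\<rbrakk> \<Longrightarrow> vectorspace K (hom_space C scal X Y)"
    and Comp_scal_left:
      "\<lbrakk>X \<in> Obj C; Y \<in> Obj C; Z \<in> Obj C; is_mor C f X Y; is_mor C g Y Z; c \<in> carrier K\<rbrakk>
        \<Longrightarrow> scal c g \<cdot> f = scal c (g \<cdot> f)"
    and Comp_scal_right:
      "\<lbrakk>X \<in> Obj C; Y \<in> Obj C; Z \<in> Obj C; is_mor C f X Y; is_mor C g Y Z; c \<in> carrier K\<rbrakk>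
        \<Longrightarrow> g \<cdot> scal c f = scal c (g \<cdot> f)"

definition hom_finite ::
  "('o, 'm, 'z) additive_cat_scheme \<Rightarrow> 'k ring \<Rightarrow> ('k \<Rightarrow> 'm \<Rightarrow> 'm) \<Rightarrow> bool" where
  "hom_finite C K scal \<longleftrightarrow>
     (\<forall>X\<in>Obj C. \<forall>Y\<in>Obj C. vectorspace.fin_dim K (hom_space C scal X Y))"

end

theory Submission
  imports Defs
begin

text \<open>
  Both sequences are chased through the long exact sequences of the two given E-triangles
  \<open>X \<rightarrow> Y \<rightarrow> Z\<close> and \<open>X' \<rightarrow> Y' \<rightarrow> Z\<close>. These long exact sequences come from comparing E-triangles by
  (ET3) and its dual, except for exactness at the extensions of (or by) the middle term, which needs
  (ET4) or its dual. The chase for \<open>C(-, T)\<close> and \<open>E(-, T)\<close> works for every \<open>\<beta>\<close>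
  making the diagram commute, but breaks down at \<open>E(Y \<boxplus> X', T)\<close>, because the long exact sequences
  stop after \<open>E\<close>.

  The missing input is \<open>homotopy_pullback\<close>: for some \<open>\<beta>0\<close> compatible with the two E-triangles the
  sequence \<open>X \<rightarrow> Y \<boxplus> X' \<rightarrow> Y'\<close> is an E-triangle with extension \<open>\<eta> = g'\<^sup>* \<delta>\<close>. It is obtained by
  realizing \<open>\<eta>\<close> as \<open>X \<rightarrow> M \<rightarrow> Y'\<close> and identifying \<open>M\<close> with \<open>Y \<boxplus> X'\<close>, using the dual of (ET4) for the
  deflations \<open>M \<rightarrow> Y' \<rightarrow> Z\<close>. The first map \<open>X \<rightarrow> Y \<boxplus> X'\<close> does not involve \<open>\<beta>\<close>, and every map
  vanishing on it factors through the row of the given \<open>\<beta>\<close> (\<open>factor_through_row\<close>). In particular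
  the row of \<open>\<beta>0\<close> does, and this transfers exactness at \<open>E(Y \<boxplus> X', T)\<close> from \<open>\<beta>0\<close> to \<open>\<beta>\<close>.

  In the covariant sequence the chase breaks down at the first and last inner terms, where the
  E-triangle supplied by semi-homotopy takes over. Its extension \<open>\<eta>'\<close> may differ from \<open>\<eta>\<close>, but at
  these two terms exactness only concerns the maps of the E-triangle.

  For semi-homotopy itself, \<open>\<beta>0 - \<beta> = s g\<close> for some \<open>s : Z \<rightarrow> Y'\<close>, so \<open>1 - s g'\<close> takes the row of \<open>\<beta>0\<close> to
  the row of \<open>\<beta>\<close>, and it suffices to choose \<open>s\<close> such that \<open>1 - s g'\<close> is invertible. The endomorphism
  \<open>r = g' s\<close> of \<open>Z\<close> vanishes on \<open>g\<close>, so \<open>s\<close> may be replaced by \<open>s (1 - v r)\<close> for any \<open>v\<close>. If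
  \<open>End(Z)\<close> is finite-dimensional, then \<open>r\<^sup>m = r\<^sup>m\<^sup>+\<^sup>1 v\<close> for some \<open>m\<close> and some \<open>v\<close> commuting with \<open>r\<close>. With this
  \<open>v\<close> the new \<open>g' s\<close> is \<open>r (1 - v r)\<close>, which is nilpotent; hence so is the new \<open>s g'\<close>.
\<close>

section \<open>Arrows and biproducts in additive categories\<close>

context abelian_group
begin

lemma add_diff_cancel: "\<lbrakk>a \<in> carrier G; b \<in> carrier G\<rbrakk> \<Longrightarrow> a \<oplus> (b \<ominus> a) = b"
  using a_lcomm[of a b "\<ominus> a"] by (simp add: minus_eq r_neg)

lemma diff_add_cancel: "\<lbrakk>a \<in> carrier G; b \<in> carrier G\<rbrakk> \<Longrightarrow> (b \<ominus> a) \<oplus> a = b"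
  by (simp add: minus_eq a_assoc l_neg)

lemma diff_diff_cancel: "\<lbrakk>a \<in> carrier G; b \<in> carrier G\<rbrakk> \<Longrightarrow> b \<ominus> (b \<ominus> a) = a"
  by (simp add: minus_eq minus_add r_neg2)

lemma diff_self: "a \<in> carrier G \<Longrightarrow> a \<ominus> a = \<zero>"
  by (simp add: minus_eq r_neg)

lemma uminus_zero: "\<ominus> \<zero> = \<zero>"
  using r_neg[OF zero_closed] by simp

lemma diff_zero: "a \<in> carrier G \<Longrightarrow> a \<ominus> \<zero> = a"
  by (simp add: minus_eq uminus_zero)

end

lemma abelian_group_hom_diff:
  assumes "abelian_group_hom G H h" "a \<in> carrier G" "b \<in> carrier G"
  shows "h (a \<ominus>\<^bsub>G\<^esub> b) = h a \<ominus>\<^bsub>H\<^esub> h b"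
proof -
  interpret abelian_group_hom G H h by fact
  show ?thesis using assms(2,3) by (simp add: G.minus_eq H.minus_eq)
qed

lemma abelian_group_hom_by_add:
  assumes "abelian_group G" "abelian_group H" "\<And>a. a \<in> carrier G \<Longrightarrow> h a \<in> carrier H"
    and "\<And>a b. \<lbrakk>a \<in> carrier G; b \<in> carrier G\<rbrakk> \<Longrightarrow> h (a \<oplus>\<^bsub>G\<^esub> b) = h a \<oplus>\<^bsub>H\<^esub> h b"
  shows "abelian_group_hom G H h"
  using assms
  by (intro abelian_group_homI group_hom.intro group_hom_axioms.intro)
    (auto simp: hom_def abelian_group.a_group)

lemma exact_atI:
  assumes "abelian_group_hom A B \<phi>" "abelian_group_hom B D \<psi>"
    and "\<And>a. a \<in> carrier A \<Longrightarrow> \<psi> (\<phi> a) = \<zero>\<^bsub>D\<^esub>"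
    and "\<And>b. \<lbrakk>b \<in> carrier B; \<psi> b = \<zero>\<^bsub>D\<^esub>\<rbrakk> \<Longrightarrow> \<exists>a \<in> carrier A. b = \<phi> a"
  shows "exact_at A \<phi> B \<psi> D"
  using assms abelian_group_hom.hom_closed[OF assms(1)]
  unfolding exact_at_def a_kernel_def' by auto

context preadditive_category
begin

text \<open>Composition is not indexed by objects, so a bare morphism does not determine its endpoints;
  carrying them along with the membership makes composability checkable by resolution.\<close>

definition arr where
  "arr f X Y \<longleftrightarrow> X \<in> Obj C \<and> Y \<in> Obj C \<and> is_mor C f X Y"

lemma arrD: "arr f X Y \<Longrightarrow> is_mor C f X Y" "arr f X Y \<Longrightarrow> X \<in> Obj C" "arr f X Y \<Longrightarrow> Y \<in> Obj C"
  by (simp_all add: arr_def)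

lemma hom_group: "arr f X Y \<Longrightarrow> abelian_group (Hom C X Y)"
  by (simp add: arr_def Hom_abelian_group)

lemma arr_id: "X \<in> Obj C \<Longrightarrow> arr (Ident C X) X X"
  by (simp add: arr_def Ident_mor)

lemma arr_comp: "\<lbrakk>arr g Y Z; arr f X Y\<rbrakk> \<Longrightarrow> arr (g \<cdot> f) X Z"
  by (auto simp: arr_def intro: Comp_mor)

lemma arr_zero: "\<lbrakk>X \<in> Obj C; Y \<in> Obj C\<rbrakk> \<Longrightarrow> arr \<zero>\<^bsub>Hom C X Y\<^esub> X Y"
  using Hom_abelian_group abelian_group.axioms(1) abelian_monoid.zero_closed by (fastforce simp: arr_def)

lemma arr_add: "\<lbrakk>arr f X Y; arr g X Y\<rbrakk> \<Longrightarrow> arr (f \<oplus>\<^bsub>Hom C X Y\<^esub> g) X Y"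
  using Hom_abelian_group abelian_group.axioms(1) abelian_monoid.a_closed by (fastforce simp: arr_def)

lemma arr_uminus: "arr f X Y \<Longrightarrow> arr (\<ominus>\<^bsub>Hom C X Y\<^esub> f) X Y"
  using Hom_abelian_group abelian_group.a_inv_closed by (fastforce simp: arr_def)

lemma arr_diff: "\<lbrakk>arr f X Y; arr g X Y\<rbrakk> \<Longrightarrow> arr (f \<ominus>\<^bsub>Hom C X Y\<^esub> g) X Y"
  using Hom_abelian_group abelian_group.minus_closed by (fastforce simp: arr_def)

lemma comp_id: "arr f X Y \<Longrightarrow> f \<cdot> Ident C X = f"
  by (auto simp: arr_def Comp_Ident)

lemma id_comp: "arr f X Y \<Longrightarrow> Ident C Y \<cdot> f = f"
  by (auto simp: arr_def Ident_Comp)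

lemma comp_assoc: "\<lbrakk>arr h Y Z; arr g X Y; arr f W X\<rbrakk> \<Longrightarrow> (h \<cdot> g) \<cdot> f = h \<cdot> (g \<cdot> f)"
  by (auto simp: arr_def intro: Comp_assoc)

lemma postcomp_hom:
  "\<lbrakk>T \<in> Obj C; arr g Y Z\<rbrakk> \<Longrightarrow> abelian_group_hom (Hom C T Y) (Hom C T Z) (\<lambda>f. g \<cdot> f)"
  by (intro abelian_group_hom_by_add)
    (auto simp: arr_def Hom_abelian_group Comp_add_right intro: Comp_mor)

lemma precomp_hom:
  "\<lbrakk>T \<in> Obj C; arr f X Y\<rbrakk> \<Longrightarrow> abelian_group_hom (Hom C Y T) (Hom C X T) (\<lambda>g. g \<cdot> f)"
  by (intro abelian_group_hom_by_add)
    (auto simp: arr_def Hom_abelian_group Comp_add_left intro: Comp_mor)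

lemma comp_zero: "\<lbrakk>T \<in> Obj C; arr g Y Z\<rbrakk> \<Longrightarrow> g \<cdot> \<zero>\<^bsub>Hom C T Y\<^esub> = \<zero>\<^bsub>Hom C T Z\<^esub>"
  using abelian_group_hom.hom_zero[OF postcomp_hom] .

lemma zero_comp: "\<lbrakk>T \<in> Obj C; arr f X Y\<rbrakk> \<Longrightarrow> \<zero>\<^bsub>Hom C Y T\<^esub> \<cdot> f = \<zero>\<^bsub>Hom C X T\<^esub>"
  using abelian_group_hom.hom_zero[OF precomp_hom] .

lemma comp_add:
  "\<lbrakk>arr g Y Z; arr f X Y; arr f' X Y\<rbrakk> \<Longrightarrow> g \<cdot> (f \<oplus>\<^bsub>Hom C X Y\<^esub> f') = g \<cdot> f \<oplus>\<^bsub>Hom C X Z\<^esub> g \<cdot> f'"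
  by (simp add: arr_def Comp_add_right)

lemma add_comp:
  "\<lbrakk>arr g Y Z; arr g' Y Z; arr f X Y\<rbrakk> \<Longrightarrow> (g \<oplus>\<^bsub>Hom C Y Z\<^esub> g') \<cdot> f = g \<cdot> f \<oplus>\<^bsub>Hom C X Z\<^esub> g' \<cdot> f"
  by (simp add: arr_def Comp_add_left)

lemma comp_diff:
  "\<lbrakk>arr g Y Z; arr f X Y; arr f' X Y\<rbrakk> \<Longrightarrow> g \<cdot> (f \<ominus>\<^bsub>Hom C X Y\<^esub> f') = g \<cdot> f \<ominus>\<^bsub>Hom C X Z\<^esub> g \<cdot> f'"
  using abelian_group_hom_diff[OF postcomp_hom] by (auto simp: arr_def)

lemma diff_comp:
  "\<lbrakk>arr g Y Z; arr g' Y Z; arr f X Y\<rbrakk> \<Longrightarrow> (g \<ominus>\<^bsub>Hom C Y Z\<^esub> g') \<cdot> f = g \<cdot> f \<ominus>\<^bsub>Hom C X Z\<^esub> g' \<cdot> f"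
  using abelian_group_hom_diff[OF precomp_hom] by (auto simp: arr_def)

lemma comp_uminus:
  "\<lbrakk>arr g Y Z; arr f X Y\<rbrakk> \<Longrightarrow> g \<cdot> (\<ominus>\<^bsub>Hom C X Y\<^esub> f) = \<ominus>\<^bsub>Hom C X Z\<^esub> (g \<cdot> f)"
  using abelian_group_hom.hom_a_inv[OF postcomp_hom] by (auto simp: arr_def)

lemma uminus_comp:
  "\<lbrakk>arr g Y Z; arr f X Y\<rbrakk> \<Longrightarrow> (\<ominus>\<^bsub>Hom C Y Z\<^esub> g) \<cdot> f = \<ominus>\<^bsub>Hom C X Z\<^esub> (g \<cdot> f)"
  using abelian_group_hom.hom_a_inv[OF precomp_hom] by (auto simp: arr_def)

lemma hom_add_zero: "arr f X Y \<Longrightarrow> f \<oplus>\<^bsub>Hom C X Y\<^esub> \<zero>\<^bsub>Hom C X Y\<^esub> = f"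
  and hom_zero_add: "arr f X Y \<Longrightarrow> \<zero>\<^bsub>Hom C X Y\<^esub> \<oplus>\<^bsub>Hom C X Y\<^esub> f = f"
  and hom_diff_zero: "arr f X Y \<Longrightarrow> f \<ominus>\<^bsub>Hom C X Y\<^esub> \<zero>\<^bsub>Hom C X Y\<^esub> = f"
  and hom_diff_self: "arr f X Y \<Longrightarrow> f \<ominus>\<^bsub>Hom C X Y\<^esub> f = \<zero>\<^bsub>Hom C X Y\<^esub>"
proof -
  assume f: "arr f X Y"
  interpret abelian_group "Hom C X Y" by (rule hom_group[OF f])
  note f = arrD(1)[OF f]
  show "f \<oplus>\<^bsub>Hom C X Y\<^esub> \<zero>\<^bsub>Hom C X Y\<^esub> = f" "\<zero>\<^bsub>Hom C X Y\<^esub> \<oplus>\<^bsub>Hom C X Y\<^esub> f = f"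
    "f \<ominus>\<^bsub>Hom C X Y\<^esub> \<zero>\<^bsub>Hom C X Y\<^esub> = f" "f \<ominus>\<^bsub>Hom C X Y\<^esub> f = \<zero>\<^bsub>Hom C X Y\<^esub>"
    using f by (simp_all add: diff_zero diff_self)
qed

lemma hom_add_diff_cancel: "\<lbrakk>arr f X Y; arr g X Y\<rbrakk> \<Longrightarrow> f \<oplus>\<^bsub>Hom C X Y\<^esub> (g \<ominus>\<^bsub>Hom C X Y\<^esub> f) = g"
  and hom_diff_add_cancel: "\<lbrakk>arr f X Y; arr g X Y\<rbrakk> \<Longrightarrow> (g \<ominus>\<^bsub>Hom C X Y\<^esub> f) \<oplus>\<^bsub>Hom C X Y\<^esub> f = g"
  and hom_diff_diff_cancel: "\<lbrakk>arr f X Y; arr g X Y\<rbrakk> \<Longrightarrow> g \<ominus>\<^bsub>Hom C X Y\<^esub> (g \<ominus>\<^bsub>Hom C X Y\<^esub> f) = f"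
  and eq_of_diff_zero: "\<lbrakk>arr f X Y; arr g X Y; g \<ominus>\<^bsub>Hom C X Y\<^esub> f = \<zero>\<^bsub>Hom C X Y\<^esub>\<rbrakk> \<Longrightarrow> g = f"
proof -
  assume fg: "arr f X Y" "arr g X Y"
  interpret abelian_group "Hom C X Y" by (rule hom_group[OF fg(1)])
  note fg = arrD(1)[OF fg(1)] arrD(1)[OF fg(2)]
  show "f \<oplus>\<^bsub>Hom C X Y\<^esub> (g \<ominus>\<^bsub>Hom C X Y\<^esub> f) = g" "(g \<ominus>\<^bsub>Hom C X Y\<^esub> f) \<oplus>\<^bsub>Hom C X Y\<^esub> f = g"
    "g \<ominus>\<^bsub>Hom C X Y\<^esub> (g \<ominus>\<^bsub>Hom C X Y\<^esub> f) = f"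
    using fg by (simp_all add: add_diff_cancel diff_add_cancel diff_diff_cancel)
  show "g = f" if "g \<ominus>\<^bsub>Hom C X Y\<^esub> f = \<zero>\<^bsub>Hom C X Y\<^esub>"
    using that diff_add_cancel[OF fg] fg by simp
qed

lemma is_isoI:
  assumes "arr k X Y" "arr l Y X" "l \<cdot> k = Ident C X" "arr l' Y X" "k \<cdot> l' = Ident C Y"
  shows "is_iso C k X Y"
proof -
  have "l' = (l \<cdot> k) \<cdot> l'" using assms by (simp add: id_comp)
  also have "\<dots> = l" using assms comp_assoc[OF assms(2,1,4)] by (simp add: comp_id)
  finally show ?thesis using assms by (auto simp: is_iso_def arr_def)
qed

lemma is_isoE:
  assumes "is_iso C k X Y" "X \<in> Obj C" "Y \<in> Obj C"
  obtains l where "arr k X Y" "arr l Y X" "l \<cdot> k = Ident C X" "k \<cdot> l = Ident C Y"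
  using assms by (auto simp: is_iso_def arr_def)

end

context additive_category
begin

lemma arr_bip:
  assumes "X \<in> Obj C" "Y \<in> Obj C"
  shows "arr (in1 C X Y) X (X \<boxplus> Y)" "arr (in2 C X Y) Y (X \<boxplus> Y)"
    "arr (pr1 C X Y) (X \<boxplus> Y) X" "arr (pr2 C X Y) (X \<boxplus> Y) Y"
  using assms by (auto simp: arr_def Bip_Obj in1_mor in2_mor pr1_mor pr2_mor)

lemma bip_arrow_eq:
  assumes "arr f (X \<boxplus> Y) T" "X \<in> Obj C" "Y \<in> Obj C"
  shows "f = (f \<cdot> in1 C X Y) \<cdot> pr1 C X Y \<oplus>\<^bsub>Hom C (X \<boxplus> Y) T\<^esub> (f \<cdot> in2 C X Y) \<cdot> pr2 C X Y"
proof -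
  note a = arr_bip[OF assms(2,3)]
  have "f = f \<cdot> Ident C (X \<boxplus> Y)" using assms by (simp add: comp_id)
  also have "\<dots> = f \<cdot> (in1 C X Y \<cdot> pr1 C X Y) \<oplus>\<^bsub>Hom C (X \<boxplus> Y) T\<^esub> f \<cdot> (in2 C X Y \<cdot> pr2 C X Y)"
    using comp_add[OF assms(1) arr_comp[OF a(1,3)] arr_comp[OF a(2,4)]] in_pr_sum[OF assms(2,3)] by simp
  finally show ?thesis
    using comp_assoc[OF assms(1) a(1,3)] comp_assoc[OF assms(1) a(2,4)] by simp
qed

lemma arrow_to_bip_eq:
  assumes "arr f T (X \<boxplus> Y)" "X \<in> Obj C" "Y \<in> Obj C"
  shows "f = in1 C X Y \<cdot> (pr1 C X Y \<cdot> f) \<oplus>\<^bsub>Hom C T (X \<boxplus> Y)\<^esub> in2 C X Y \<cdot> (pr2 C X Y \<cdot> f)"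
proof -
  note a = arr_bip[OF assms(2,3)]
  have "f = Ident C (X \<boxplus> Y) \<cdot> f" using assms by (simp add: id_comp)
  also have "\<dots> = (in1 C X Y \<cdot> pr1 C X Y) \<cdot> f \<oplus>\<^bsub>Hom C T (X \<boxplus> Y)\<^esub> (in2 C X Y \<cdot> pr2 C X Y) \<cdot> f"
    using add_comp[OF arr_comp[OF a(1,3)] arr_comp[OF a(2,4)] assms(1)] in_pr_sum[OF assms(2,3)] by simp
  finally show ?thesis
    using comp_assoc[OF a(1,3) assms(1)] comp_assoc[OF a(2,4) assms(1)] by simp
qed

lemma eq_on_bip:
  assumes "arr f (X \<boxplus> Y) T" "arr f' (X \<boxplus> Y) T" "X \<in> Obj C" "Y \<in> Obj C"
    and "f \<cdot> in1 C X Y = f' \<cdot> in1 C X Y" "f \<cdot> in2 C X Y = f' \<cdot> in2 C X Y"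
  shows "f = f'"
  using bip_arrow_eq[OF assms(1,3,4)] bip_arrow_eq[OF assms(2,3,4)] assms(5,6) by metis

lemma eq_to_bip:
  assumes "arr f T (X \<boxplus> Y)" "arr f' T (X \<boxplus> Y)" "X \<in> Obj C" "Y \<in> Obj C"
    and "pr1 C X Y \<cdot> f = pr1 C X Y \<cdot> f'" "pr2 C X Y \<cdot> f = pr2 C X Y \<cdot> f'"
  shows "f = f'"
  using arrow_to_bip_eq[OF assms(1,3,4)] arrow_to_bip_eq[OF assms(2,3,4)] assms(5,6) by metis

lemma col_simps:
  assumes "arr a T X" "arr b T Y"
  shows arr_col: "arr (col C T X Y a b) T (X \<boxplus> Y)"
    and pr1_col: "pr1 C X Y \<cdot> col C T X Y a b = a"
    and pr2_col: "pr2 C X Y \<cdot> col C T X Y a b = b"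
proof -
  have o: "X \<in> Obj C" "Y \<in> Obj C" "T \<in> Obj C" using assms by (auto simp: arr_def)
  note i = arr_bip[OF o(1,2)]
  note ia = arr_comp[OF i(1) assms(1)] and ib = arr_comp[OF i(2) assms(2)]
  show "arr (col C T X Y a b) T (X \<boxplus> Y)"
    unfolding col_def using arr_add[OF ia ib] .
  show "pr1 C X Y \<cdot> col C T X Y a b = a"
    unfolding col_def comp_add[OF i(3) ia ib]
    using comp_assoc[OF i(3,1) assms(1), symmetric] comp_assoc[OF i(3,2) assms(2), symmetric] o assms
    by (simp add: pr1_in1 pr1_in2 id_comp zero_comp[OF o(1) assms(2)] hom_add_zero)
  show "pr2 C X Y \<cdot> col C T X Y a b = b"
    unfolding col_def comp_add[OF i(4) ia ib]
    using comp_assoc[OF i(4,1) assms(1), symmetric] comp_assoc[OF i(4,2) assms(2), symmetric] o assms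
    by (simp add: pr2_in2 pr2_in1 id_comp zero_comp[OF o(2) assms(1)] hom_zero_add)
qed

lemma row_simps:
  assumes "arr a X T" "arr b Y T"
  shows arr_row: "arr (row C X Y T a b) (X \<boxplus> Y) T"
    and row_in1: "row C X Y T a b \<cdot> in1 C X Y = a"
    and row_in2: "row C X Y T a b \<cdot> in2 C X Y = b"
proof -
  have o: "X \<in> Obj C" "Y \<in> Obj C" "T \<in> Obj C" using assms by (auto simp: arr_def)
  note i = arr_bip[OF o(1,2)]
  note ia = arr_comp[OF assms(1) i(3)] and ib = arr_comp[OF assms(2) i(4)]
  show "arr (row C X Y T a b) (X \<boxplus> Y) T"
    unfolding row_def using arr_add[OF ia ib] .
  show "row C X Y T a b \<cdot> in1 C X Y = a"
    unfolding row_def add_comp[OF ia ib i(1)]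
    using comp_assoc[OF assms(1) i(3,1)] comp_assoc[OF assms(2) i(4,1)] o assms
    by (simp add: pr1_in1 pr2_in1 comp_id comp_zero[OF o(1) assms(2)] hom_add_zero)
  show "row C X Y T a b \<cdot> in2 C X Y = b"
    unfolding row_def add_comp[OF ia ib i(2)]
    using comp_assoc[OF assms(1) i(3,2)] comp_assoc[OF assms(2) i(4,2)] o assms
    by (simp add: pr2_in2 pr1_in2 comp_id comp_zero[OF o(2) assms(1)] hom_zero_add)
qed

lemma comp_col:
  assumes "arr h (X \<boxplus> Y) W" "arr a T X" "arr b T Y"
  shows "h \<cdot> col C T X Y a b = (h \<cdot> in1 C X Y) \<cdot> a \<oplus>\<^bsub>Hom C T W\<^esub> (h \<cdot> in2 C X Y) \<cdot> b"
proof -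
  note i = arr_bip[OF arrD(3)[OF assms(2)] arrD(3)[OF assms(3)]]
  show ?thesis
    unfolding col_def comp_add[OF assms(1) arr_comp[OF i(1) assms(2)] arr_comp[OF i(2) assms(3)]]
    using comp_assoc[OF assms(1) i(1) assms(2)] comp_assoc[OF assms(1) i(2) assms(3)] by simp
qed

lemma row_comp:
  assumes "arr h W (X \<boxplus> Y)" "arr a X T" "arr b Y T"
  shows "row C X Y T a b \<cdot> h = a \<cdot> (pr1 C X Y \<cdot> h) \<oplus>\<^bsub>Hom C W T\<^esub> b \<cdot> (pr2 C X Y \<cdot> h)"
proof -
  note i = arr_bip[OF arrD(2)[OF assms(2)] arrD(2)[OF assms(3)]]
  show ?thesis
    unfolding row_def add_comp[OF arr_comp[OF assms(2) i(3)] arr_comp[OF assms(3) i(4)] assms(1)]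
    using comp_assoc[OF assms(2) i(3) assms(1)] comp_assoc[OF assms(3) i(4) assms(1)] by simp
qed

text \<open>The difference between the two composites of a square, as one composite through the biproduct.\<close>

lemma row_col_defect:
  assumes "arr b Y Y'" "arr f' X' Y'" "arr f X Y" "arr \<alpha> X X'"
  shows "row C Y X' Y' b (\<ominus>\<^bsub>Hom C X' Y'\<^esub> f') \<cdot> col C X Y X' f \<alpha> = b \<cdot> f \<ominus>\<^bsub>Hom C X Y'\<^esub> f' \<cdot> \<alpha>"
proof -
  note l = arr_uminus[OF assms(2)]
  interpret abelian_group "Hom C X Y'" by (rule hom_group[OF arr_comp[OF assms(1,3)]])
  show ?thesis
    unfolding comp_col[OF arr_row[OF assms(1) l] assms(3,4)] row_in1[OF assms(1) l]
      row_in2[OF assms(1) l] uminus_comp[OF assms(2,4)] minus_eq ..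
qed

end

section \<open>Extensions and their realizations\<close>

context additive_bifunctor
begin

definition extn where
  "extn \<delta> Z X \<longleftrightarrow> Z \<in> Obj C \<and> X \<in> Obj C \<and> \<delta> \<in> carrier (Ext C Z X)"

lemma extnD: "extn \<delta> Z X \<Longrightarrow> \<delta> \<in> carrier (Ext C Z X)" "extn \<delta> Z X \<Longrightarrow> Z \<in> Obj C" "extn \<delta> Z X \<Longrightarrow> X \<in> Obj C"
  by (simp_all add: extn_def)

lemma ext_group: "extn \<delta> Z X \<Longrightarrow> abelian_group (Ext C Z X)"
  by (simp add: extn_def Ext_abelian_group)

lemma extn_zero: "\<lbrakk>Z \<in> Obj C; X \<in> Obj C\<rbrakk> \<Longrightarrow> extn \<zero>\<^bsub>Ext C Z X\<^esub> Z X"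
  using Ext_abelian_group abelian_group.axioms(1) abelian_monoid.zero_closed by (fastforce simp: extn_def)

lemma extn_diff: "\<lbrakk>extn \<delta> Z X; extn \<rho> Z X\<rbrakk> \<Longrightarrow> extn (\<delta> \<ominus>\<^bsub>Ext C Z X\<^esub> \<rho>) Z X"
  using Ext_abelian_group abelian_group.minus_closed by (fastforce simp: extn_def)

lemma push_hom:
  "\<lbrakk>Z \<in> Obj C; arr f X X'\<rbrakk> \<Longrightarrow> abelian_group_hom (Ext C Z X) (Ext C Z X') (push C Z f)"
  using Emap_hom[of Z Z X X' "Ident C Z" f] by (simp add: push_def[abs_def] arr_def Ident_mor)

lemma pull_hom:
  "\<lbrakk>X \<in> Obj C; arr g Z' Z\<rbrakk> \<Longrightarrow> abelian_group_hom (Ext C Z X) (Ext C Z' X) (pull C X g)"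
  using Emap_hom[of Z Z' X X g "Ident C X"] by (simp add: pull_def[abs_def] arr_def Ident_mor)

lemma extn_push: "\<lbrakk>arr f X X'; extn \<delta> Z X\<rbrakk> \<Longrightarrow> extn (push C Z f \<delta>) Z X'"
  using abelian_group_hom.hom_closed[OF push_hom] by (auto simp: extn_def arr_def)

lemma extn_pull: "\<lbrakk>arr g Z' Z; extn \<delta> Z X\<rbrakk> \<Longrightarrow> extn (pull C X g \<delta>) Z' X"
  using abelian_group_hom.hom_closed[OF pull_hom] by (auto simp: extn_def arr_def)

lemma push_zero: "\<lbrakk>Z \<in> Obj C; arr f X X'\<rbrakk> \<Longrightarrow> push C Z f \<zero>\<^bsub>Ext C Z X\<^esub> = \<zero>\<^bsub>Ext C Z X'\<^esub>"
  using abelian_group_hom.hom_zero[OF push_hom] .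

lemma pull_zero: "\<lbrakk>X \<in> Obj C; arr g Z' Z\<rbrakk> \<Longrightarrow> pull C X g \<zero>\<^bsub>Ext C Z X\<^esub> = \<zero>\<^bsub>Ext C Z' X\<^esub>"
  using abelian_group_hom.hom_zero[OF pull_hom] .

lemma pull_diff:
  "\<lbrakk>arr g Z' Z; extn \<delta> Z X; extn \<rho> Z X\<rbrakk>
    \<Longrightarrow> pull C X g (\<delta> \<ominus>\<^bsub>Ext C Z X\<^esub> \<rho>) = pull C X g \<delta> \<ominus>\<^bsub>Ext C Z' X\<^esub> pull C X g \<rho>"
  using abelian_group_hom_diff[OF pull_hom] by (auto simp: extn_def)

lemma push_id: "extn \<delta> Z X \<Longrightarrow> push C Z (Ident C X) \<delta> = \<delta>"
  and pull_id: "extn \<delta> Z X \<Longrightarrow> pull C X (Ident C Z) \<delta> = \<delta>"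
  by (simp_all add: push_def pull_def extn_def Emap_Ident)

lemma push_comp:
  assumes "arr f' X' X''" "arr f X X'" "extn \<delta> Z X"
  shows "push C Z (f' \<cdot> f) \<delta> = push C Z f' (push C Z f \<delta>)"
  using Emap_Comp[of Z Z Z X X' X'' "Ident C Z" "Ident C Z" f f' \<delta>] assms
  by (simp add: push_def arr_def extn_def Ident_mor Ident_Comp)

lemma pull_comp:
  assumes "arr g Z' Z" "arr g' Z'' Z'" "extn \<delta> Z X"
  shows "pull C X (g \<cdot> g') \<delta> = pull C X g' (pull C X g \<delta>)"
  using Emap_Comp[of Z Z' Z'' X X X g g' "Ident C X" "Ident C X" \<delta>] assms
  by (simp add: pull_def arr_def extn_def Ident_mor Ident_Comp)

lemma push_pull:
  assumes "arr f X X'" "arr g Z' Z" "extn \<delta> Z X"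
  shows "push C Z' f (pull C X g \<delta>) = pull C X' g (push C Z f \<delta>)"
proof -
  have "push C Z' f (pull C X g \<delta>) = Emap C g f \<delta>"
    using Emap_Comp[of Z Z' Z' X X X' g "Ident C Z'" "Ident C X" f \<delta>] assms
    by (simp add: push_def pull_def arr_def extn_def Ident_mor Comp_Ident)
  also have "\<dots> = pull C X' g (push C Z f \<delta>)"
    using Emap_Comp[of Z Z Z' X X' X' "Ident C Z" g f "Ident C X'" \<delta>] assms
    by (simp add: push_def pull_def arr_def extn_def Ident_mor Ident_Comp)
  finally show ?thesis .
qed

lemma push_along_hom:
  assumes "extn \<delta> Z X" "T \<in> Obj C"
  shows "abelian_group_hom (Hom C X T) (Ext C Z T) (\<lambda>f. push C Z f \<delta>)"
  using assms Emap_add_right[of Z Z X T "Ident C Z"] extn_push[OF _ assms(1)]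
  by (intro abelian_group_hom_by_add)
    (auto simp: extn_def arr_def Hom_abelian_group Ext_abelian_group push_def Ident_mor)

lemma pull_along_hom:
  assumes "extn \<delta> Z X" "T \<in> Obj C"
  shows "abelian_group_hom (Hom C T Z) (Ext C T X) (\<lambda>g. pull C X g \<delta>)"
  using assms Emap_add_left[of Z T X X _ _ "Ident C X"] extn_pull[OF _ assms(1)]
  by (intro abelian_group_hom_by_add)
    (auto simp: extn_def arr_def Hom_abelian_group Ext_abelian_group pull_def Ident_mor)

lemma push_zero_arrow: "\<lbrakk>extn \<delta> Z X; T \<in> Obj C\<rbrakk> \<Longrightarrow> push C Z \<zero>\<^bsub>Hom C X T\<^esub> \<delta> = \<zero>\<^bsub>Ext C Z T\<^esub>"
  using abelian_group_hom.hom_zero[OF push_along_hom] .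

lemma pull_zero_arrow: "\<lbrakk>extn \<delta> Z X; T \<in> Obj C\<rbrakk> \<Longrightarrow> pull C X \<zero>\<^bsub>Hom C T Z\<^esub> \<delta> = \<zero>\<^bsub>Ext C T X\<^esub>"
  using abelian_group_hom.hom_zero[OF pull_along_hom] .

lemma push_add_arrow:
  "\<lbrakk>arr f X T; arr f' X T; extn \<delta> Z X\<rbrakk>
    \<Longrightarrow> push C Z (f \<oplus>\<^bsub>Hom C X T\<^esub> f') \<delta> = push C Z f \<delta> \<oplus>\<^bsub>Ext C Z T\<^esub> push C Z f' \<delta>"
  using abelian_group_hom.hom_add[OF push_along_hom] by (auto simp: arr_def)

lemma push_diff_arrow:
  "\<lbrakk>arr f X T; arr f' X T; extn \<delta> Z X\<rbrakk>
    \<Longrightarrow> push C Z (f \<ominus>\<^bsub>Hom C X T\<^esub> f') \<delta> = push C Z f \<delta> \<ominus>\<^bsub>Ext C Z T\<^esub> push C Z f' \<delta>"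
  using abelian_group_hom_diff[OF push_along_hom] by (auto simp: arr_def)

lemma pull_add_arrow:
  "\<lbrakk>arr g T Z; arr g' T Z; extn \<delta> Z X\<rbrakk>
    \<Longrightarrow> pull C X (g \<oplus>\<^bsub>Hom C T Z\<^esub> g') \<delta> = pull C X g \<delta> \<oplus>\<^bsub>Ext C T X\<^esub> pull C X g' \<delta>"
  using abelian_group_hom.hom_add[OF pull_along_hom] by (auto simp: arr_def)

lemma push_uminus_arrow:
  "\<lbrakk>arr f X T; extn \<delta> Z X\<rbrakk> \<Longrightarrow> push C Z (\<ominus>\<^bsub>Hom C X T\<^esub> f) \<delta> = \<ominus>\<^bsub>Ext C Z T\<^esub> push C Z f \<delta>"
  using abelian_group_hom.hom_a_inv[OF push_along_hom] by (auto simp: arr_def)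

lemma pull_uminus_arrow:
  "\<lbrakk>arr g T Z; extn \<delta> Z X\<rbrakk> \<Longrightarrow> pull C X (\<ominus>\<^bsub>Hom C T Z\<^esub> g) \<delta> = \<ominus>\<^bsub>Ext C T X\<^esub> pull C X g \<delta>"
  using abelian_group_hom.hom_a_inv[OF pull_along_hom] by (auto simp: arr_def)

lemma ext_diff_self: "extn \<delta> Z X \<Longrightarrow> \<delta> \<ominus>\<^bsub>Ext C Z X\<^esub> \<delta> = \<zero>\<^bsub>Ext C Z X\<^esub>"
  using abelian_group.diff_self[OF ext_group] by (auto simp: extn_def)

lemma ext_diff_diff_cancel:
  "\<lbrakk>extn \<delta> Z X; extn \<rho> Z X\<rbrakk> \<Longrightarrow> \<delta> \<ominus>\<^bsub>Ext C Z X\<^esub> (\<delta> \<ominus>\<^bsub>Ext C Z X\<^esub> \<rho>) = \<rho>"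
  using abelian_group.diff_diff_cancel[OF ext_group] by (auto simp: extn_def)

text \<open>Both lemmas decompose the identity of the biproduct and use additivity of the action.\<close>

lemma pull_bip_zero:
  assumes "extn \<delta> (X \<boxplus> Y) T" "X \<in> Obj C" "Y \<in> Obj C"
    and "pull C T (in1 C X Y) \<delta> = \<zero>\<^bsub>Ext C X T\<^esub>" "pull C T (in2 C X Y) \<delta> = \<zero>\<^bsub>Ext C Y T\<^esub>"
  shows "\<delta> = \<zero>\<^bsub>Ext C (X \<boxplus> Y) T\<^esub>"
proof -
  note i = arr_bip[OF assms(2,3)] and T = extnD(3)[OF assms(1)]
  interpret E: abelian_group "Ext C (X \<boxplus> Y) T" by (rule ext_group[OF assms(1)])
  have "\<delta> = pull C T (in1 C X Y \<cdot> pr1 C X Y \<oplus>\<^bsub>Hom C (X \<boxplus> Y) (X \<boxplus> Y)\<^esub> in2 C X Y \<cdot> pr2 C X Y) \<delta>"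
    using assms by (simp add: in_pr_sum pull_id)
  also have "\<dots> = \<zero>\<^bsub>Ext C (X \<boxplus> Y) T\<^esub>"
    unfolding pull_add_arrow[OF arr_comp[OF i(1,3)] arr_comp[OF i(2,4)] assms(1)]
      pull_comp[OF i(1,3) assms(1)] pull_comp[OF i(2,4) assms(1)]
    by (simp add: assms(4,5) pull_zero[OF T i(3)] pull_zero[OF T i(4)])
  finally show ?thesis .
qed

lemma push_bip_zero:
  assumes "extn \<delta> T (X \<boxplus> Y)" "X \<in> Obj C" "Y \<in> Obj C"
    and "push C T (pr1 C X Y) \<delta> = \<zero>\<^bsub>Ext C T X\<^esub>" "push C T (pr2 C X Y) \<delta> = \<zero>\<^bsub>Ext C T Y\<^esub>"
  shows "\<delta> = \<zero>\<^bsub>Ext C T (X \<boxplus> Y)\<^esub>"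
proof -
  note i = arr_bip[OF assms(2,3)] and T = extnD(2)[OF assms(1)]
  interpret E: abelian_group "Ext C T (X \<boxplus> Y)" by (rule ext_group[OF assms(1)])
  have "\<delta> = push C T (in1 C X Y \<cdot> pr1 C X Y \<oplus>\<^bsub>Hom C (X \<boxplus> Y) (X \<boxplus> Y)\<^esub> in2 C X Y \<cdot> pr2 C X Y) \<delta>"
    using assms by (simp add: in_pr_sum push_id)
  also have "\<dots> = \<zero>\<^bsub>Ext C T (X \<boxplus> Y)\<^esub>"
    unfolding push_add_arrow[OF arr_comp[OF i(1,3)] arr_comp[OF i(2,4)] assms(1)]
      push_comp[OF i(1,3) assms(1)] push_comp[OF i(2,4) assms(1)]
    by (simp add: assms(4,5) push_zero[OF T i(1)] push_zero[OF T i(2)])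
  finally show ?thesis .
qed

lemma triangleD:
  assumes "E_triangle C X f Y g Z \<delta>"
  shows "arr f X Y" "arr g Y Z" "extn \<delta> Z X"
  using assms by (auto simp: E_triangle_def sequences_def arr_def extn_def)

lemma seq_equiv_equiv:
  assumes "X \<in> Obj C" "Z \<in> Obj C"
  shows "equiv (sequences C X Z) (seq_equiv C X Z)"
proof (rule equivI)
  show "seq_equiv C X Z \<subseteq> sequences C X Z \<times> sequences C X Z"
    by (auto simp: seq_equiv_def)
  show "refl_on (sequences C X Z) (seq_equiv C X Z)"
  proof (rule refl_onI)
    fix s assume s: "s \<in> sequences C X Z"
    obtain f Y g where e: "s = (f, Y, g)" by (cases s)
    have a: "arr f X Y" "arr g Y Z" "Y \<in> Obj C"
      using s assms by (auto simp: e sequences_def arr_def)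
    have "is_iso C (Ident C Y) Y Y"
      using arr_id[OF a(3)] id_comp[OF arr_id[OF a(3)]] by (auto simp: is_iso_def arr_def)
    then show "(s, s) \<in> seq_equiv C X Z"
      using s id_comp[OF a(1)] comp_id[OF a(2)] by (auto simp: e seq_equiv_def)
  qed
  show "sym (seq_equiv C X Z)"
  proof (rule symI)
    fix s s' assume s: "(s, s') \<in> seq_equiv C X Z"
    obtain f Y g f' Y' g' where e: "s = (f, Y, g)" "s' = (f', Y', g')" by (cases s, cases s') auto
    obtain k where k: "is_iso C k Y Y'" "k \<cdot> f = f'" "g' \<cdot> k = g"
      using s by (auto simp: e seq_equiv_def)
    have a: "arr f X Y" "arr g' Y' Z"
      using s assms by (auto simp: e seq_equiv_def sequences_def arr_def)
    obtain l where l: "arr k Y Y'" "arr l Y' Y" "l \<cdot> k = Ident C Y" "k \<cdot> l = Ident C Y'"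
      using is_isoE[OF k(1) arrD(3)[OF a(1)] arrD(2)[OF a(2)]] .
    have "is_iso C l Y' Y" using l by (auto simp: is_iso_def arr_def)
    moreover have "l \<cdot> f' = f" "g \<cdot> l = g'"
      using comp_assoc[OF l(2,1) a(1)] comp_assoc[OF a(2) l(1,2)] k l a by (simp_all add: id_comp comp_id)
    ultimately show "(s', s) \<in> seq_equiv C X Z" using s by (auto simp: e seq_equiv_def)
  qed
  show "trans (seq_equiv C X Z)"
  proof (rule transI)
    fix s s' s'' assume s: "(s, s') \<in> seq_equiv C X Z" and s': "(s', s'') \<in> seq_equiv C X Z"
    obtain f Y g f' Y' g' f'' Y'' g''
      where e: "s = (f, Y, g)" "s' = (f', Y', g')" "s'' = (f'', Y'', g'')"
      by (cases s, cases s', cases s'') auto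
    have a: "arr f X Y" "arr f' X Y'" "arr g'' Y'' Z"
      using s s' assms by (auto simp: e seq_equiv_def sequences_def arr_def)
    obtain k where k: "is_iso C k Y Y'" "k \<cdot> f = f'" "g' \<cdot> k = g"
      using s by (auto simp: e seq_equiv_def)
    obtain k' where k': "is_iso C k' Y' Y''" "k' \<cdot> f' = f''" "g'' \<cdot> k' = g'"
      using s' by (auto simp: e seq_equiv_def)
    obtain l where l: "arr k Y Y'" "arr l Y' Y" "l \<cdot> k = Ident C Y" "k \<cdot> l = Ident C Y'"
      using is_isoE[OF k(1) arrD(3)[OF a(1)] arrD(3)[OF a(2)]] .
    obtain l' where l': "arr k' Y' Y''" "arr l' Y'' Y'" "l' \<cdot> k' = Ident C Y'" "k' \<cdot> l' = Ident C Y''"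
      using is_isoE[OF k'(1) arrD(3)[OF a(2)] arrD(2)[OF a(3)]] .
    note kk = arr_comp[OF l'(1) l(1)] and ll = arr_comp[OF l(2) l'(2)]
    have "(l \<cdot> l') \<cdot> (k' \<cdot> k) = Ident C Y"
      using comp_assoc[OF l(2) l'(2) kk] comp_assoc[OF l'(2,1) l(1)] l l' by (simp add: id_comp[OF l(1)])
    moreover have "(k' \<cdot> k) \<cdot> (l \<cdot> l') = Ident C Y''"
      using comp_assoc[OF l'(1) l(1) ll] comp_assoc[OF l(1,2) l'(2)] l l' by (simp add: id_comp[OF l'(2)])
    ultimately have "is_iso C (k' \<cdot> k) Y Y''" using is_isoI[OF kk ll _ ll] by simp
    moreover have "(k' \<cdot> k) \<cdot> f = f''" "g'' \<cdot> (k' \<cdot> k) = g"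
      using comp_assoc[OF l'(1) l(1) a(1)] comp_assoc[OF a(3) l'(1) l(1)] k k' by simp_all
    ultimately show "(s, s'') \<in> seq_equiv C X Z" using s s' by (auto simp: e seq_equiv_def)
  qed
qed

text \<open>The realization is a full equivalence class of sequences, so it contains every sequence
  isomorphic to a representative.\<close>

lemma triangle_transport:
  assumes t: "E_triangle C X f Y g Z \<delta>" and k: "is_iso C k Y Y'" and Y': "Y' \<in> Obj C"
    and g': "arr g' Y' Z" and e: "g' \<cdot> k = g"
  shows "E_triangle C X (k \<cdot> f) Y' g' Z \<delta>"
proof -
  note a = triangleD[OF t]
  have "arr k Y Y'" using is_isoE[OF k arrD(3)[OF a(1)] Y'] .
  note kf = arr_comp[OF this a(1)]
  have o: "X \<in> Obj C" "Z \<in> Obj C" using a by (auto simp: arr_def)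
  have "((f, Y, g), (k \<cdot> f, Y', g')) \<in> seq_equiv C X Z"
    using k e a kf g' by (auto simp: seq_equiv_def sequences_def arr_def)
  then have "seq_class C X Z f Y g = seq_class C X Z (k \<cdot> f) Y' g'"
    unfolding seq_class_def by (rule equiv_class_eq[OF seq_equiv_equiv[OF o]])
  then show ?thesis
    using t kf g' by (auto simp: E_triangle_def sequences_def arr_def)
qed

end

context additive_realization
begin

lemma realized:
  assumes "extn \<delta> Z X"
  obtains f Y g where "E_triangle C X f Y g Z \<delta>"
proof -
  have "Realize C Z X \<delta> \<in> sequences C X Z // seq_equiv C X Z"
    using assms by (auto simp: extn_def intro: Realize_class)
  then obtain s where s: "s \<in> sequences C X Z" "Realize C Z X \<delta> = seq_equiv C X Z `` {s}"
    by (auto elim: quotientE)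
  obtain f Y g where "s = (f, Y, g)" by (cases s)
  then have "E_triangle C X f Y g Z \<delta>"
    using s assms by (auto simp: E_triangle_def extn_def seq_class_def)
  then show ?thesis by (rule that)
qed

lemma split_triangle:
  assumes "X \<in> Obj C" "Z \<in> Obj C"
  shows "E_triangle C X (in1 C X Z) (X \<boxplus> Z) (pr2 C X Z) Z \<zero>\<^bsub>Ext C Z X\<^esub>"
  using assms arr_bip[OF assms] Realize_zero[OF assms(2,1)] extn_zero[OF assms(2,1)]
  by (auto simp: E_triangle_def sequences_def arr_def extn_def)

lemma triangle_filler:
  assumes "E_triangle C X f Y g Z \<delta>" "E_triangle C X' f' Y' g' Z' \<delta>'"
    and "arr \<alpha> X X'" "arr \<gamma> Z Z'" "push C Z \<alpha> \<delta> = pull C X' \<gamma> \<delta>'"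
  obtains \<beta> where "arr \<beta> Y Y'" "\<beta> \<cdot> f = f' \<cdot> \<alpha>" "g' \<cdot> \<beta> = \<gamma> \<cdot> g"
  using Realize_morphism[OF assms(1,2) arrD(1)[OF assms(3)] arrD(1)[OF assms(4)] assms(5)]
    triangleD[OF assms(1)] triangleD[OF assms(2)]
  by (auto simp: arr_def)

end

section \<open>The long exact sequences of an E-triangle\<close>

context extriangulated_category
begin

lemma ET3_arr:
  assumes "E_triangle C X f Y g Z \<delta>" "E_triangle C X' f' Y' g' Z' \<delta>'"
    and "arr \<alpha> X X'" "arr \<beta> Y Y'" "\<beta> \<cdot> f = f' \<cdot> \<alpha>"
  obtains \<gamma> where "arr \<gamma> Z Z'" "g' \<cdot> \<beta> = \<gamma> \<cdot> g" "push C Z \<alpha> \<delta> = pull C X' \<gamma> \<delta>'"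
  using ET3[OF assms(1,2) arrD(1)[OF assms(3)] arrD(1)[OF assms(4)] assms(5)]
    triangleD[OF assms(1)] triangleD[OF assms(2)]
  by (auto simp: arr_def E_triangle_morphism_def)

lemma ET3_op_arr:
  assumes "E_triangle C X f Y g Z \<delta>" "E_triangle C X' f' Y' g' Z' \<delta>'"
    and "arr \<beta> Y Y'" "arr \<gamma> Z Z'" "\<gamma> \<cdot> g = g' \<cdot> \<beta>"
  obtains \<alpha> where "arr \<alpha> X X'" "\<beta> \<cdot> f = f' \<cdot> \<alpha>" "push C Z \<alpha> \<delta> = pull C X' \<gamma> \<delta>'"
  using ET3_op[OF assms(1,2) arrD(1)[OF assms(3)] arrD(1)[OF assms(4)] assms(5)]
    triangleD[OF assms(1)] triangleD[OF assms(2)]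
  by (auto simp: arr_def E_triangle_morphism_def)

context
  fixes A x B y D \<delta>
  assumes tri: "E_triangle C A x B y D \<delta>"
begin

private lemma x: "arr x A B" and y: "arr y B D" and \<delta>: "extn \<delta> D A"
  using triangleD[OF tri] .

private lemma A: "A \<in> Obj C" and B: "B \<in> Obj C" and D: "D \<in> Obj C"
  using x y by (auto simp: arr_def)

text \<open>Each of the next lemmas compares the given E-triangle with a split one, by (ET3), its dual, or
  the defining property of the realization.\<close>

lemma push_inflation: "push C D x \<delta> = \<zero>\<^bsub>Ext C D B\<^esub>"
proof -
  note s = split_triangle[OF B B] and b = arr_bip[OF B B]
  obtain \<gamma> where "arr \<gamma> D B" "push C D x \<delta> = pull C B \<gamma> \<zero>\<^bsub>Ext C B B\<^esub>"
    using ET3_arr[OF tri s x b(1) refl] .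
  then show ?thesis using pull_zero[OF B] by simp
qed

lemma pull_deflation: "pull C A y \<delta> = \<zero>\<^bsub>Ext C B A\<^esub>"
proof -
  note s = split_triangle[OF B B] and b = arr_bip[OF B B]
  obtain \<gamma> where "arr \<gamma> B A" "push C B \<gamma> \<zero>\<^bsub>Ext C B B\<^esub> = pull C A y \<delta>"
    using ET3_op_arr[OF s tri b(4) y refl] .
  then show ?thesis using push_zero[OF B] by simp
qed

lemma deflation_inflation: "y \<cdot> x = \<zero>\<^bsub>Hom C A D\<^esub>"
proof -
  note s = split_triangle[OF A B] and b = arr_bip[OF A B]
  note xp = arr_comp[OF x b(3)]
  have xpi: "(x \<cdot> pr1 C A B) \<cdot> in1 C A B = x \<cdot> Ident C A"
    using comp_assoc[OF x b(3,1)] A B by (simp add: pr1_in1)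
  obtain \<gamma> where \<gamma>: "arr \<gamma> B D" "y \<cdot> (x \<cdot> pr1 C A B) = \<gamma> \<cdot> pr2 C A B"
    using ET3_arr[OF s tri arr_id[OF A] xp xpi] .
  have "y \<cdot> x = (y \<cdot> (x \<cdot> pr1 C A B)) \<cdot> in1 C A B"
    using comp_assoc[OF y xp b(1)] xpi by (simp add: comp_id[OF x])
  also have "\<dots> = \<gamma> \<cdot> \<zero>\<^bsub>Hom C A B\<^esub>"
    using comp_assoc[OF \<gamma>(1) b(4,1)] A B by (simp add: \<gamma>(2) pr2_in1)
  finally show ?thesis using comp_zero[OF A \<gamma>(1)] by simp
qed

lemma factor_through_deflation:
  assumes b: "arr b B T" and bx: "b \<cdot> x = \<zero>\<^bsub>Hom C A T\<^esub>"
  obtains c where "arr c D T" "b = c \<cdot> y"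
proof -
  have T: "T \<in> Obj C" using b by (simp add: arr_def)
  note s = split_triangle[OF T T] and i = arr_bip[OF T T]
  note ib = arr_comp[OF i(2) b]
  have "(in2 C T T \<cdot> b) \<cdot> x = in1 C T T \<cdot> \<zero>\<^bsub>Hom C A T\<^esub>"
    using comp_assoc[OF i(2) b x] by (simp add: bx comp_zero[OF A i(1)] comp_zero[OF A i(2)])
  then obtain c where c: "arr c D T" "pr2 C T T \<cdot> (in2 C T T \<cdot> b) = c \<cdot> y"
    using ET3_arr[OF tri s arr_zero[OF A T] ib] by metis
  then have "b = c \<cdot> y" using comp_assoc[OF i(4,2) b] T by (simp add: pr2_in2 id_comp[OF b])
  then show ?thesis using c that by blast
qed

lemma factor_through_inflation:
  assumes b: "arr b T B" and yb: "y \<cdot> b = \<zero>\<^bsub>Hom C T D\<^esub>"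
  obtains a where "arr a T A" "b = x \<cdot> a"
proof -
  have T: "T \<in> Obj C" using b by (simp add: arr_def)
  note s = split_triangle[OF T T] and i = arr_bip[OF T T]
  note ib = arr_comp[OF b i(3)]
  have "\<zero>\<^bsub>Hom C T D\<^esub> \<cdot> pr2 C T T = y \<cdot> (b \<cdot> pr1 C T T)"
    using comp_assoc[OF y b i(3)] by (simp add: yb zero_comp[OF D i(3)] zero_comp[OF D i(4)])
  then obtain a where a: "arr a T A" "(b \<cdot> pr1 C T T) \<cdot> in1 C T T = x \<cdot> a"
    using ET3_op_arr[OF s tri ib arr_zero[OF T D]] by metis
  then have "b = x \<cdot> a" using comp_assoc[OF b i(3,1)] T by (simp add: pr1_in1 comp_id[OF b])
  then show ?thesis using a that by blast
qed

lemma extend_along_inflation: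
  assumes a: "arr a A T" and z: "push C D a \<delta> = \<zero>\<^bsub>Ext C D T\<^esub>"
  obtains b where "arr b B T" "a = b \<cdot> x"
proof -
  have T: "T \<in> Obj C" using a by (simp add: arr_def)
  note s = split_triangle[OF T T] and i = arr_bip[OF T T] and o = arr_zero[OF D T]
  have "push C D a \<delta> = pull C T \<zero>\<^bsub>Hom C D T\<^esub> \<zero>\<^bsub>Ext C T T\<^esub>"
    using z pull_zero[OF T o] by simp
  then obtain \<beta> where \<beta>: "arr \<beta> B (T \<boxplus> T)" "\<beta> \<cdot> x = in1 C T T \<cdot> a"
    using triangle_filler[OF tri s a o] by metis
  have "a = (pr1 C T T \<cdot> \<beta>) \<cdot> x"
    using comp_assoc[OF i(3) \<beta>(1) x] comp_assoc[OF i(3,1) a] T \<beta>(2)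
    by (simp add: pr1_in1 id_comp[OF a])
  then show ?thesis using arr_comp[OF i(3) \<beta>(1)] that by blast
qed

lemma lift_along_deflation:
  assumes c: "arr c T D" and z: "pull C A c \<delta> = \<zero>\<^bsub>Ext C T A\<^esub>"
  obtains b where "arr b T B" "c = y \<cdot> b"
proof -
  have T: "T \<in> Obj C" using c by (simp add: arr_def)
  note s = split_triangle[OF T T] and i = arr_bip[OF T T] and o = arr_zero[OF T A]
  have "push C T \<zero>\<^bsub>Hom C T A\<^esub> \<zero>\<^bsub>Ext C T T\<^esub> = pull C A c \<delta>"
    using z push_zero[OF T o] by simp
  then obtain \<beta> where \<beta>: "arr \<beta> (T \<boxplus> T) B" "y \<cdot> \<beta> = c \<cdot> pr2 C T T"
    using triangle_filler[OF s tri o c] by metis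
  have "c = y \<cdot> (\<beta> \<cdot> in2 C T T)"
    using comp_assoc[OF y \<beta>(1) i(2)] comp_assoc[OF c i(4,2)] T \<beta>(2)
    by (simp add: pr2_in2 comp_id[OF c])
  then show ?thesis using arr_comp[OF \<beta>(1) i(2)] that by blast
qed

end

context
  fixes A x B y D \<delta>
  assumes tri: "E_triangle C A x B y D \<delta>"
begin

text \<open>In a realization \<open>T \<rightarrow> W \<rightarrow> D\<close> of \<open>\<rho>\<close> the deflation \<open>y\<close> lifts to \<open>W\<close>, because \<open>y\<^sup>* \<rho> = 0\<close>. The lift and
  the identity of \<open>D\<close> then form a square, which (ET3) dualized completes to a morphism of E-triangles.\<close>

lemma extension_killed_by_deflation:
  assumes \<rho>: "extn \<rho> D T" and z: "pull C T y \<rho> = \<zero>\<^bsub>Ext C B T\<^esub>"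
  obtains a where "arr a A T" "\<rho> = push C D a \<delta>"
proof -
  note y = triangleD(2)[OF tri]
  note D = arrD(3)[OF y]
  obtain m W n where t: "E_triangle C T m W n D \<rho>" using realized[OF \<rho>] .
  note w = triangleD[OF t]
  obtain b where b: "arr b B W" "y = n \<cdot> b"
    using lift_along_deflation[OF t y z] .
  have "Ident C D \<cdot> y = n \<cdot> b" using b id_comp[OF y] by simp
  then obtain a where "arr a A T" "push C D a \<delta> = pull C T (Ident C D) \<rho>"
    using ET3_op_arr[OF tri t b(1) arr_id[OF D]] by metis
  then show ?thesis using that pull_id[OF \<rho>] by simp
qed

lemma extension_killed_by_inflation:
  assumes \<rho>: "extn \<rho> T A" and z: "push C T x \<rho> = \<zero>\<^bsub>Ext C T B\<^esub>"
  obtains c where "arr c T D" "\<rho> = pull C A c \<delta>"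
proof -
  note x = triangleD(1)[OF tri]
  note A = arrD(2)[OF x]
  obtain m W n where t: "E_triangle C A m W n T \<rho>" using realized[OF \<rho>] .
  note w = triangleD[OF t]
  obtain b where b: "arr b W B" "x = b \<cdot> m"
    using extend_along_inflation[OF t x z] .
  have "b \<cdot> m = x \<cdot> Ident C A" using b comp_id[OF x] by simp
  then obtain c where "arr c T D" "push C T (Ident C A) \<rho> = pull C A c \<delta>"
    using ET3_arr[OF t tri arr_id[OF A] b(1)] by metis
  then show ?thesis using that push_id[OF \<rho>] by simp
qed

text \<open>The composite of a deflation realizing \<open>\<rho>\<close> with \<open>y\<close> is again a deflation, say onto \<open>D\<close> with
  extension \<open>\<epsilon>\<close> by some \<open>P\<close>. As \<open>x\<^sup>* \<rho> = 0\<close>, the inflation \<open>f : T \<rightarrow> P\<close> splits, and a retraction of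
  \<open>f\<close> turns \<open>f\<^sub>* \<rho> = y\<^sup>* \<epsilon>\<close> into the desired factorization.\<close>

lemma extension_of_middle_from_third:
  assumes \<rho>: "extn \<rho> B T" and z: "pull C T x \<rho> = \<zero>\<^bsub>Ext C A T\<^esub>"
  obtains \<sigma> where "extn \<sigma> D T" "\<rho> = pull C T y \<sigma>"
proof -
  note y = triangleD(2)[OF tri]
  obtain m W n where t: "E_triangle C T m W n B \<rho>" using realized[OF \<rho>] .
  obtain P f g \<theta> u v \<epsilon> where p: "E_triangle C T f P g A \<theta>" "E_triangle C P u W v D \<epsilon>"
      "ET4_relations C T P D B f g \<theta> u v \<epsilon> m n \<rho> x y \<delta>"
    using ET4_op[OF t tri] by blast
  note f = triangleD[OF p(1)] and \<epsilon> = triangleD(3)[OF p(2)]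
  have rel: "\<theta> = \<zero>\<^bsub>Ext C A T\<^esub>" "push C B f \<rho> = pull C P y \<epsilon>"
    using p(3) z by (auto simp: ET4_relations_def)
  have T: "T \<in> Obj C" using \<rho> by (simp add: extn_def)
  have "push C A (Ident C T) \<theta> = \<zero>\<^bsub>Ext C A T\<^esub>" using push_id[OF f(3)] rel by simp
  then obtain r where r: "arr r P T" "Ident C T = r \<cdot> f"
    using extend_along_inflation[OF p(1) arr_id[OF T]]
    by metis
  have "\<rho> = push C B r (push C B f \<rho>)"
    using push_comp[OF r(1) f(1) \<rho>] r(2) push_id[OF \<rho>] by simp
  also have "\<dots> = pull C T y (push C D r \<epsilon>)"
    using push_pull[OF r(1) y \<epsilon>] rel by simp
  finally show ?thesis using that extn_push[OF r(1) \<epsilon>] by blast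
qed

lemma extension_of_middle_from_first:
  assumes \<rho>: "extn \<rho> T B" and z: "push C T y \<rho> = \<zero>\<^bsub>Ext C T D\<^esub>"
  obtains \<sigma> where "extn \<sigma> T A" "\<rho> = push C T x \<sigma>"
proof -
  note x = triangleD(1)[OF tri]
  obtain m W n where t: "E_triangle C B m W n T \<rho>" using realized[OF \<rho>] .
  obtain F h k \<theta> w q \<eta> where p: "E_triangle C A h W k F \<theta>" "E_triangle C D w F q T \<eta>"
      "ET4_relations C A B T F x y \<delta> m n \<rho> h k \<theta> w q \<eta>"
    using ET4[OF tri t] by blast
  note q = triangleD[OF p(2)] and \<theta> = triangleD(3)[OF p(1)]
  have rel: "\<eta> = \<zero>\<^bsub>Ext C T D\<^esub>" "push C F x \<theta> = pull C B q \<rho>"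
    using p(3) z by (auto simp: ET4_relations_def)
  have T: "T \<in> Obj C" using \<rho> by (simp add: extn_def)
  have "pull C D (Ident C T) \<eta> = \<zero>\<^bsub>Ext C T D\<^esub>" using pull_id[OF q(3)] rel by simp
  then obtain s where s: "arr s T F" "Ident C T = q \<cdot> s"
    using lift_along_deflation[OF p(2) arr_id[OF T]]
    by metis
  have "\<rho> = pull C B s (pull C B q \<rho>)"
    using pull_comp[OF q(2) s(1) \<rho>] s(2) pull_id[OF \<rho>] by simp
  also have "\<dots> = push C T x (pull C A s \<theta>)"
    using push_pull[OF x s(1) \<theta>] rel by simp
  finally show ?thesis using that extn_pull[OF s(1) \<theta>] by blast
qed

text \<open>The difference \<open>d = k - 1\<close> factors as \<open>x \<cdot> s\<close> and as \<open>t \<cdot> y\<close>, so \<open>k \<cdot> d = d = d \<cdot> k\<close>, and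
  \<open>1 - d\<close> is the inverse of \<open>k\<close>.\<close>

lemma middle_endomorphism_iso:
  assumes k: "arr k B B" and kx: "k \<cdot> x = x" and yk: "y \<cdot> k = y"
  shows "is_iso C k B B"
proof -
  note x = triangleD(1)[OF tri] and y = triangleD(2)[OF tri]
  note B = arrD(3)[OF x]
  define d where "d = k \<ominus>\<^bsub>Hom C B B\<^esub> Ident C B"
  note i = arr_id[OF B]
  have d: "arr d B B" unfolding d_def using arr_diff[OF k i] .
  have "d \<cdot> x = \<zero>\<^bsub>Hom C A B\<^esub>"
    unfolding d_def diff_comp[OF k i x] by (simp add: kx id_comp[OF x] hom_diff_self[OF x])
  then obtain t where t: "arr t D B" "d = t \<cdot> y" using factor_through_deflation[OF tri d] by blast
  have "y \<cdot> d = \<zero>\<^bsub>Hom C B D\<^esub>"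
    unfolding d_def comp_diff[OF y k i] by (simp add: yk comp_id[OF y] hom_diff_self[OF y])
  then obtain s where s: "arr s B A" "d = x \<cdot> s" using factor_through_inflation[OF tri d] by blast
  have kd: "k \<cdot> d = d" using comp_assoc[OF k x s(1)] kx s(2) by simp
  have dk: "d \<cdot> k = d" using comp_assoc[OF t(1) y k] yk t(2) by simp
  define l where "l = Ident C B \<ominus>\<^bsub>Hom C B B\<^esub> d"
  have l: "arr l B B" unfolding l_def using arr_diff[OF i d] .
  have "k \<ominus>\<^bsub>Hom C B B\<^esub> d = Ident C B" unfolding d_def using hom_diff_diff_cancel[OF i k] .
  then have "l \<cdot> k = Ident C B" "k \<cdot> l = Ident C B"
    unfolding l_def diff_comp[OF i d k] comp_diff[OF k i d]
    by (simp_all add: kd dk id_comp[OF k] comp_id[OF k])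
  then show ?thesis using is_isoI[OF k l _ l] by blast
qed

end

text \<open>A realization of \<open>(c\<inverse>)\<^sup>* \<delta>\<close> maps to the given E-triangle and back; both round trips fix the outer
  maps, so they are isomorphisms by \<open>middle_endomorphism_iso\<close>.\<close>

lemma triangle_iso_end:
  assumes t: "E_triangle C X f Y g Z \<delta>" and c: "is_iso C c Z Z'" and Z': "Z' \<in> Obj C"
  shows "\<exists>\<delta>'. E_triangle C X f Y (c \<cdot> g) Z' \<delta>'"
proof -
  note a = triangleD[OF t]
  have o: "X \<in> Obj C" "Y \<in> Obj C" "Z \<in> Obj C" using a by (auto simp: arr_def)
  obtain l where l: "arr c Z Z'" "arr l Z' Z" "l \<cdot> c = Ident C Z" "c \<cdot> l = Ident C Z'"
    using is_isoE[OF c o(3) Z'] .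
  define \<delta>' where "\<delta>' = pull C X l \<delta>"
  have \<delta>': "extn \<delta>' Z' X" unfolding \<delta>'_def using extn_pull[OF l(2) a(3)] .
  obtain f1 W g1 where t1: "E_triangle C X f1 W g1 Z' \<delta>'" using realized[OF \<delta>'] .
  note a1 = triangleD[OF t1] and iX = arr_id[OF o(1)]
  have "push C Z (Ident C X) \<delta> = pull C X c \<delta>'"
    using pull_comp[OF l(2,1) a(3)] l(3) a(3) by (simp add: \<delta>'_def push_id pull_id)
  then obtain b where b: "arr b Y W" "b \<cdot> f = f1" "g1 \<cdot> b = c \<cdot> g"
    using triangle_filler[OF t t1 iX l(1)] comp_id[OF a1(1)] by metis
  have "push C Z' (Ident C X) \<delta>' = pull C X l \<delta>"
    using \<delta>' by (simp add: push_id) (simp add: \<delta>'_def)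
  then obtain b' where b': "arr b' W Y" "b' \<cdot> f1 = f" "g \<cdot> b' = l \<cdot> g1"
    using triangle_filler[OF t1 t iX l(2)] comp_id[OF a(1)] by metis
  have iso: "is_iso C b' W Y"
  proof -
    note k = arr_comp[OF b'(1) b(1)] and k' = arr_comp[OF b(1) b'(1)]
    have "(b' \<cdot> b) \<cdot> f = f" "g \<cdot> (b' \<cdot> b) = g"
      using comp_assoc[OF b'(1) b(1) a(1)] comp_assoc[OF a(2) b'(1) b(1)] comp_assoc[OF l(2) a1(2) b(1)]
        comp_assoc[OF l(2,1) a(2)] b b' l(3) by (simp_all add: id_comp[OF a(2)])
    then have iso1: "is_iso C (b' \<cdot> b) Y Y" using middle_endomorphism_iso[OF t k] by blast
    have "(b \<cdot> b') \<cdot> f1 = f1" "g1 \<cdot> (b \<cdot> b') = g1"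
      using comp_assoc[OF b(1) b'(1) a1(1)] comp_assoc[OF a1(2) b(1) b'(1)] comp_assoc[OF l(1) a(2) b'(1)]
        comp_assoc[OF l(1,2) a1(2)] b b' l(4) by (simp_all add: id_comp[OF a1(2)])
    then have iso2: "is_iso C (b \<cdot> b') W W" using middle_endomorphism_iso[OF t1 k'] by blast
    have W: "W \<in> Obj C" using b by (simp add: arr_def)
    obtain m where m: "arr m Y Y" "(b' \<cdot> b) \<cdot> m = Ident C Y" using is_isoE[OF iso1 o(2) o(2)] by metis
    obtain n where n: "arr n W W" "n \<cdot> (b \<cdot> b') = Ident C W" using is_isoE[OF iso2 W W] by metis
    show ?thesis
      using is_isoI[OF b'(1) arr_comp[OF n(1) b(1)] _ arr_comp[OF b(1) m(1)]]
        comp_assoc[OF n(1) b(1) b'(1)] comp_assoc[OF b'(1) b(1) m(1)] m(2) n(2) by simp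
  qed
  have "(c \<cdot> g) \<cdot> b' = g1"
    using comp_assoc[OF l(1) a(2) b'(1)] comp_assoc[OF l(1,2) a1(2)] b'(3) l(4) id_comp[OF a1(2)] by simp
  then have "E_triangle C X f Y (c \<cdot> g) Z' \<delta>'"
    using triangle_transport[OF t1 iso o(2) arr_comp[OF l(1) a(2)]] b'(2) by simp
  then show ?thesis by blast
qed

end

section \<open>The homotopy pullback of a morphism of E-triangles\<close>

context extriangulated_category
begin

lemma split_inflation_section:
  assumes t: "E_triangle C X f P g X' \<zero>\<^bsub>Ext C X' X\<^esub>" and r: "arr r P X" and rf: "r \<cdot> f = Ident C X"
  obtains \<sigma> where "arr \<sigma> X' P" "g \<cdot> \<sigma> = Ident C X'" "r \<cdot> \<sigma> = \<zero>\<^bsub>Hom C X' X\<^esub>"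
    "f \<cdot> r \<oplus>\<^bsub>Hom C P P\<^esub> \<sigma> \<cdot> g = Ident C P"
proof -
  note a = triangleD[OF t]
  have o: "X \<in> Obj C" "P \<in> Obj C" "X' \<in> Obj C" using a by (auto simp: arr_def)
  note i = arr_id[OF o(2)] and fr = arr_comp[OF a(1) r]
  define e where "e = Ident C P \<ominus>\<^bsub>Hom C P P\<^esub> f \<cdot> r"
  have e: "arr e P P" unfolding e_def using arr_diff[OF i fr] .
  have "e \<cdot> f = \<zero>\<^bsub>Hom C X P\<^esub>"
    unfolding e_def diff_comp[OF i fr a(1)] comp_assoc[OF a(1) r a(1)]
    by (simp add: rf id_comp[OF a(1)] comp_id[OF a(1)] hom_diff_self[OF a(1)])
  then obtain \<sigma> where \<sigma>: "arr \<sigma> X' P" "e = \<sigma> \<cdot> g" using factor_through_deflation[OF t e] by blast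
  have ge: "g \<cdot> e = g"
    unfolding e_def comp_diff[OF a(2) i fr] comp_assoc[OF a(2) a(1) r, symmetric]
    by (simp add: deflation_inflation[OF t] zero_comp[OF o(3) r] comp_id[OF a(2)] hom_diff_zero[OF a(2)])
  have re: "r \<cdot> e = \<zero>\<^bsub>Hom C P X\<^esub>"
    unfolding e_def comp_diff[OF r i fr] comp_assoc[OF r a(1) r, symmetric]
    by (simp add: rf id_comp[OF r] comp_id[OF r] hom_diff_self[OF r])
  obtain s where s: "arr s X' P" "Ident C X' = g \<cdot> s"
    using lift_along_deflation[OF t arr_id[OF o(3)]] pull_id[OF a(3)] by metis
  have "g \<cdot> \<sigma> = (g \<cdot> \<sigma>) \<cdot> (g \<cdot> s)"
    using comp_id[OF arr_comp[OF a(2) \<sigma>(1)]] s by simp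
  also have "\<dots> = (g \<cdot> (\<sigma> \<cdot> g)) \<cdot> s"
    using comp_assoc[OF arr_comp[OF a(2) \<sigma>(1)] a(2) s(1)] comp_assoc[OF a(2) \<sigma>(1) a(2)] by simp
  finally have 1: "g \<cdot> \<sigma> = Ident C X'" using ge \<sigma>(2) s by simp
  have "r \<cdot> \<sigma> = (r \<cdot> \<sigma>) \<cdot> (g \<cdot> s)"
    using comp_id[OF arr_comp[OF r \<sigma>(1)]] s by simp
  also have "\<dots> = (r \<cdot> (\<sigma> \<cdot> g)) \<cdot> s"
    using comp_assoc[OF arr_comp[OF r \<sigma>(1)] a(2) s(1)] comp_assoc[OF r \<sigma>(1) a(2)] by simp
  finally have 2: "r \<cdot> \<sigma> = \<zero>\<^bsub>Hom C X' X\<^esub>" using re \<sigma>(2) zero_comp[OF o(1) s(1)] by simp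
  have "f \<cdot> r \<oplus>\<^bsub>Hom C P P\<^esub> \<sigma> \<cdot> g = Ident C P"
    using hom_add_diff_cancel[OF fr i] \<sigma>(2) by (simp add: e_def)
  with 1 2 \<sigma>(1) show ?thesis using that by blast
qed

text \<open>Let \<open>X \<rightarrow> M \<rightarrow> Y'\<close> realize \<open>g'\<^sup>* \<delta>\<close>. Its deflation \<open>n\<close> followed by \<open>g'\<close> is a deflation onto \<open>Z\<close>; its
  kernel \<open>P\<close> is an extension of \<open>X'\<close> by \<open>X\<close> with class \<open>(g' f')\<^sup>* \<delta> = 0\<close>, hence a biproduct with injections
  \<open>e\<close>, \<open>\<sigma>\<close> and projections \<open>r\<close>, \<open>h\<close>. In these coordinates the extension \<open>\<epsilon>\<close> realized by
  \<open>P \<rightarrow> M \<rightarrow> Z\<close> has components \<open>\<delta>\<close> and \<open>- \<alpha>\<^sub>* \<delta>\<close>.\<close>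

lemma pullback_decomposition:
  assumes t: "E_triangle C X f Y g Z \<delta>" and t': "E_triangle C X' f' Y' g' Z (push C Z \<alpha> \<delta>)"
    and \<alpha>: "arr \<alpha> X X'"
  obtains m M n P u \<epsilon> e h r \<sigma> where
    "E_triangle C X m M n Y' (pull C X g' \<delta>)" "E_triangle C P u M (g' \<cdot> n) Z \<epsilon>"
    "arr e X P" "arr h P X'" "arr r P X" "arr \<sigma> X' P"
    "m = u \<cdot> e" "n \<cdot> u = (\<ominus>\<^bsub>Hom C X' Y'\<^esub> f') \<cdot> h"
    "r \<cdot> e = Ident C X" "h \<cdot> e = \<zero>\<^bsub>Hom C X X'\<^esub>" "r \<cdot> \<sigma> = \<zero>\<^bsub>Hom C X' X\<^esub>" "h \<cdot> \<sigma> = Ident C X'"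
    "e \<cdot> r \<oplus>\<^bsub>Hom C P P\<^esub> \<sigma> \<cdot> h = Ident C P"
    "push C Z r \<epsilon> = \<delta>" "push C Z (\<alpha> \<cdot> r \<oplus>\<^bsub>Hom C P X'\<^esub> h) \<epsilon> = \<zero>\<^bsub>Ext C Z X'\<^esub>"
proof -
  note a = triangleD[OF t] and a' = triangleD[OF t']
  have o: "X \<in> Obj C" "X' \<in> Obj C" "Z \<in> Obj C" using \<alpha> a by (auto simp: arr_def)
  define \<eta> where "\<eta> = pull C X g' \<delta>"
  have \<eta>: "extn \<eta> Y' X" unfolding \<eta>_def using extn_pull[OF a'(2) a(3)] .
  obtain m M n where tM: "E_triangle C X m M n Y' \<eta>" using realized[OF \<eta>] .
  note am = triangleD[OF tM]
  obtain P e q \<theta> u v \<epsilon> where tP: "E_triangle C X e P q X' \<theta>" "E_triangle C P u M v Z \<epsilon>"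
      and rel: "ET4_relations C X P Z Y' e q \<theta> u v \<epsilon> m n \<eta> f' g' (push C Z \<alpha> \<delta>)"
    using ET4_op[OF tM t'] by blast
  note p = triangleD[OF tP(1)] and u = triangleD[OF tP(2)]
  have P: "P \<in> Obj C" using p by (simp add: arr_def)
  have m: "m = u \<cdot> e" and nu: "f' \<cdot> q = n \<cdot> u" and v: "v = g' \<cdot> n" and \<theta>: "pull C X f' \<eta> = \<theta>"
    and q\<epsilon>: "push C Z q \<epsilon> = push C Z \<alpha> \<delta>" and e\<eta>: "push C Y' e \<eta> = pull C P g' \<epsilon>"
    using rel by (auto simp: ET4_relations_def)
  have "\<theta> = \<zero>\<^bsub>Ext C X' X\<^esub>"
    using pull_comp[OF a'(2,1) a(3)] deflation_inflation[OF t'] pull_zero_arrow[OF a(3) o(2)] \<theta>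
    by (simp add: \<eta>_def)
  note tP0 = tP(1)[unfolded this]
  obtain r0 where r0: "arr r0 P X" "Ident C X = r0 \<cdot> e"
    using extend_along_inflation[OF tP0 arr_id[OF o(1)] push_zero[OF o(2) arr_id[OF o(1)]]] .
  \<comment> \<open>The retraction \<open>r0\<close> gives \<open>\<delta>\<close> only up to the kernel of \<open>g'\<^sup>*\<close>, which consists of the extensions
    \<open>s\<^sub>* \<alpha>\<^sub>* \<delta>\<close>; subtracting \<open>s \<cdot> q\<close> removes this error.\<close>
  note r0\<epsilon> = extn_push[OF r0(1) u(3)]
  define \<rho> where "\<rho> = push C Z r0 \<epsilon> \<ominus>\<^bsub>Ext C Z X\<^esub> \<delta>"
  have \<rho>: "extn \<rho> Z X" unfolding \<rho>_def using extn_diff[OF r0\<epsilon> a(3)] .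
  have "pull C X g' (push C Z r0 \<epsilon>) = push C Y' r0 (push C Y' e \<eta>)"
    using push_pull[OF r0(1) a'(2) u(3)] e\<eta> by simp
  also have "\<dots> = \<eta>" using push_comp[OF r0(1) p(1) \<eta>] r0(2) push_id[OF \<eta>] by simp
  finally have "pull C X g' \<rho> = \<zero>\<^bsub>Ext C Y' X\<^esub>"
    unfolding \<rho>_def pull_diff[OF a'(2) r0\<epsilon> a(3)] using ext_diff_self[OF \<eta>] by (simp add: \<eta>_def)
  then obtain s where s: "arr s X' X" "\<rho> = push C Z s (push C Z \<alpha> \<delta>)"
    using extension_killed_by_deflation[OF t' \<rho>] by blast
  note sq = arr_comp[OF s(1) p(2)]
  define r where "r = r0 \<ominus>\<^bsub>Hom C P X\<^esub> s \<cdot> q"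
  have r: "arr r P X" unfolding r_def using arr_diff[OF r0(1) sq] .
  have re: "r \<cdot> e = Ident C X"
    unfolding r_def diff_comp[OF r0(1) sq p(1)] comp_assoc[OF s(1) p(2,1)] r0(2)[symmetric]
      deflation_inflation[OF tP(1)] comp_zero[OF o(1) s(1)] hom_diff_zero[OF arr_id[OF o(1)]] ..
  have "push C Z r \<epsilon> = push C Z r0 \<epsilon> \<ominus>\<^bsub>Ext C Z X\<^esub> \<rho>"
    unfolding r_def push_diff_arrow[OF r0(1) sq u(3)] push_comp[OF s(1) p(2) u(3)] q\<epsilon> s(2) ..
  then have r\<epsilon>: "push C Z r \<epsilon> = \<delta>" unfolding \<rho>_def using ext_diff_diff_cancel[OF r0\<epsilon> a(3)] by simp
  obtain \<tau> where \<tau>: "arr \<tau> X' P" "q \<cdot> \<tau> = Ident C X'" "r \<cdot> \<tau> = \<zero>\<^bsub>Hom C X' X\<^esub>"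
      "e \<cdot> r \<oplus>\<^bsub>Hom C P P\<^esub> \<tau> \<cdot> q = Ident C P"
    using split_inflation_section[OF tP0 r re] .
  \<comment> \<open>The second coordinate is negated so that \<open>n \<cdot> u \<cdot> \<sigma>\<close> becomes \<open>- f'\<close>.\<close>
  define h where "h = \<ominus>\<^bsub>Hom C P X'\<^esub> q"
  define \<sigma> where "\<sigma> = \<ominus>\<^bsub>Hom C X' P\<^esub> \<tau>"
  have h: "arr h P X'" unfolding h_def using arr_uminus[OF p(2)] .
  have \<sigma>: "arr \<sigma> X' P" unfolding \<sigma>_def using arr_uminus[OF \<tau>(1)] .
  have uu: "\<ominus>\<^bsub>Hom C A B\<^esub> (\<ominus>\<^bsub>Hom C A B\<^esub> x) = x" if "arr x A B" for x A B
    using abelian_group.minus_minus[OF hom_group[OF that]] arrD(1)[OF that] by simp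
  have zz: "\<ominus>\<^bsub>Hom C A B\<^esub> \<zero>\<^bsub>Hom C A B\<^esub> = \<zero>\<^bsub>Hom C A B\<^esub>" if "A \<in> Obj C" "B \<in> Obj C" for A B
    using abelian_group.uminus_zero Hom_abelian_group[OF that] by blast
  have 1: "n \<cdot> u = (\<ominus>\<^bsub>Hom C X' Y'\<^esub> f') \<cdot> h"
    unfolding h_def uminus_comp[OF a'(1) arr_uminus[OF p(2)]] comp_uminus[OF a'(1) p(2)]
    using uu[OF arr_comp[OF a'(1) p(2)]] nu by simp
  have 2: "h \<cdot> e = \<zero>\<^bsub>Hom C X X'\<^esub>"
    unfolding h_def uminus_comp[OF p(2,1)] deflation_inflation[OF tP(1)] zz[OF o(1,2)] ..
  have 3: "r \<cdot> \<sigma> = \<zero>\<^bsub>Hom C X' X\<^esub>"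
    unfolding \<sigma>_def comp_uminus[OF r \<tau>(1)] \<tau>(3) zz[OF o(2,1)] ..
  have 4: "h \<cdot> \<sigma> = Ident C X'"
    unfolding h_def \<sigma>_def uminus_comp[OF p(2) arr_uminus[OF \<tau>(1)]] comp_uminus[OF p(2) \<tau>(1)] \<tau>(2)
      uu[OF arr_id[OF o(2)]] ..
  have "\<sigma> \<cdot> h = \<tau> \<cdot> q"
    unfolding h_def \<sigma>_def uminus_comp[OF \<tau>(1) arr_uminus[OF p(2)]] comp_uminus[OF \<tau>(1) p(2)]
      uu[OF arr_comp[OF \<tau>(1) p(2)]] ..
  then have 5: "e \<cdot> r \<oplus>\<^bsub>Hom C P P\<^esub> \<sigma> \<cdot> h = Ident C P" using \<tau>(4) by simp
  interpret E: abelian_group "Ext C Z X'" by (rule ext_group[OF a'(3)])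
  have "push C Z (\<alpha> \<cdot> r \<oplus>\<^bsub>Hom C P X'\<^esub> h) \<epsilon> = \<zero>\<^bsub>Ext C Z X'\<^esub>"
    unfolding push_add_arrow[OF arr_comp[OF \<alpha> r] h u(3)] push_comp[OF \<alpha> r u(3)] r\<epsilon>
    unfolding h_def push_uminus_arrow[OF p(2) u(3)] q\<epsilon>
    using E.r_neg extnD(1)[OF a'(3)] by simp
  with that[OF tM[unfolded \<eta>_def] tP(2)[unfolded v] p(1) h r \<sigma> m 1 re 2 3 4 5 r\<epsilon>]
  show ?thesis by blast
qed

text \<open>With the decomposition above, \<open>\<epsilon>\<close> is carried to \<open>(\<delta>, 0)\<close> by the isomorphism
  \<open>(r, \<alpha> r + h) : P \<rightarrow> X \<boxplus> X'\<close>, and \<open>(\<delta>, 0)\<close> is realized with middle term \<open>Y \<boxplus> X'\<close>.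
  This is why \<open>M \<cong> Y \<boxplus> X'\<close>; here the isomorphism is built from its components \<open>b : M \<rightarrow> Y\<close> and
  \<open>c : M \<rightarrow> X'\<close>, which extend \<open>f r\<close> and \<open>\<alpha> r + h\<close> along \<open>P \<rightarrow> M\<close>.\<close>

lemma homotopy_pullback:
  assumes t: "E_triangle C X f Y g Z \<delta>" and t': "E_triangle C X' f' Y' g' Z (push C Z \<alpha> \<delta>)"
    and \<alpha>: "arr \<alpha> X X'"
  obtains \<beta> where "arr \<beta> Y Y'" "\<beta> \<cdot> f = f' \<cdot> \<alpha>" "g' \<cdot> \<beta> = g"
    "E_triangle C X (col C X Y X' f \<alpha>) (Y \<boxplus> X') (row C Y X' Y' \<beta> (\<ominus>\<^bsub>Hom C X' Y'\<^esub> f')) Y' (pull C X g' \<delta>)"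
proof -
  note a = triangleD[OF t] and a' = triangleD[OF t']
  have o: "X \<in> Obj C" "Y \<in> Obj C" "Z \<in> Obj C" "X' \<in> Obj C" "Y' \<in> Obj C"
    using \<alpha> a a' by (auto simp: arr_def)
  define l where "l = \<ominus>\<^bsub>Hom C X' Y'\<^esub> f'"
  have l: "arr l X' Y'" unfolding l_def using arr_uminus[OF a'(1)] .
  obtain m M n P u \<epsilon> e h r \<sigma> where tM: "E_triangle C X m M n Y' (pull C X g' \<delta>)"
    and tP: "E_triangle C P u M (g' \<cdot> n) Z \<epsilon>"
    and e: "arr e X P" and h: "arr h P X'" and r: "arr r P X" and \<sigma>: "arr \<sigma> X' P"
    and m: "m = u \<cdot> e" and nu: "n \<cdot> u = l \<cdot> h"
    and re: "r \<cdot> e = Ident C X" and he: "h \<cdot> e = \<zero>\<^bsub>Hom C X X'\<^esub>" and r\<sigma>: "r \<cdot> \<sigma> = \<zero>\<^bsub>Hom C X' X\<^esub>"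
    and h\<sigma>: "h \<cdot> \<sigma> = Ident C X'"
    and sum: "e \<cdot> r \<oplus>\<^bsub>Hom C P P\<^esub> \<sigma> \<cdot> h = Ident C P"
    and r\<epsilon>: "push C Z r \<epsilon> = \<delta>" and w\<epsilon>: "push C Z (\<alpha> \<cdot> r \<oplus>\<^bsub>Hom C P X'\<^esub> h) \<epsilon> = \<zero>\<^bsub>Ext C Z X'\<^esub>"
    using pullback_decomposition[OF t t' \<alpha>] unfolding l_def by metis
  note n = triangleD(2)[OF tM] and u = triangleD[OF tP]
  define v where "v = g' \<cdot> n"
  have v: "arr v M Z" using u(2) by (simp add: v_def)
  have P: "P \<in> Obj C" and M: "M \<in> Obj C" using u by (auto simp: arr_def)
  note \<alpha>r = arr_comp[OF \<alpha> r]
  define w where "w = \<alpha> \<cdot> r \<oplus>\<^bsub>Hom C P X'\<^esub> h"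
  have w: "arr w P X'" unfolding w_def using arr_add[OF \<alpha>r h] .
  obtain c where c: "arr c M X'" "w = c \<cdot> u"
    using extend_along_inflation[OF tP w] w\<epsilon> unfolding w_def by blast
  obtain b where b: "arr b M Y" "b \<cdot> u = f \<cdot> r" "g \<cdot> b = v"
    using triangle_filler[OF tP t r arr_id[OF o(3)]] r\<epsilon> pull_id[OF a(3)] id_comp[OF v]
    unfolding v_def by metis
  define j where "j = u \<cdot> \<sigma>"
  have j: "arr j X' M" unfolding j_def using arr_comp[OF u(1) \<sigma>] .
  have bj: "b \<cdot> j = \<zero>\<^bsub>Hom C X' Y\<^esub>"
    unfolding j_def comp_assoc[OF b(1) u(1) \<sigma>, symmetric] b(2) comp_assoc[OF a(1) r \<sigma>] r\<sigma>
      comp_zero[OF o(4) a(1)] ..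
  have w\<sigma>: "w \<cdot> \<sigma> = Ident C X'"
    unfolding w_def add_comp[OF \<alpha>r h \<sigma>] comp_assoc[OF \<alpha> r \<sigma>] r\<sigma> h\<sigma> comp_zero[OF o(4) \<alpha>]
      hom_zero_add[OF arr_id[OF o(4)]] ..
  have cj: "c \<cdot> j = Ident C X'"
    unfolding j_def comp_assoc[OF c(1) u(1) \<sigma>, symmetric] c(2)[symmetric] w\<sigma> ..
  have nj: "n \<cdot> j = l"
    unfolding j_def comp_assoc[OF n u(1) \<sigma>, symmetric] nu comp_assoc[OF l h \<sigma>] h\<sigma> comp_id[OF l] ..
  have bm: "b \<cdot> m = f"
    unfolding m comp_assoc[OF b(1) u(1) e, symmetric] b(2) comp_assoc[OF a(1) r e] re comp_id[OF a(1)] ..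
  have "w \<cdot> e = \<alpha>"
    unfolding w_def add_comp[OF \<alpha>r h e] comp_assoc[OF \<alpha> r e] re he comp_id[OF \<alpha>] hom_add_zero[OF \<alpha>] ..
  then have cm: "c \<cdot> m = \<alpha>"
    unfolding m comp_assoc[OF c(1) u(1) e, symmetric] c(2)[symmetric] .
  \<comment> \<open>\<open>\<tau>\<close> is the first injection of \<open>P\<close> in the new coordinates \<open>(r, w)\<close>, so \<open>\<tau>\<^sub>* \<delta> = \<epsilon>\<close>; it provides the
    candidate \<open>k : Y \<rightarrow> M\<close> for the first injection of \<open>M\<close>.\<close>
  define \<tau> where "\<tau> = e \<ominus>\<^bsub>Hom C X P\<^esub> \<sigma> \<cdot> \<alpha>"
  note \<sigma>\<alpha> = arr_comp[OF \<sigma> \<alpha>]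
  have \<tau>: "arr \<tau> X P" unfolding \<tau>_def using arr_diff[OF e \<sigma>\<alpha>] .
  note \<tau>r = arr_comp[OF \<tau> r] and \<sigma>w = arr_comp[OF \<sigma> w]
  have \<tau>r_sum: "\<tau> \<cdot> r \<oplus>\<^bsub>Hom C P P\<^esub> \<sigma> \<cdot> w = Ident C P"
  proof -
    interpret H: abelian_group "Hom C P P" by (rule hom_group[OF \<tau>r])
    note cl = arrD(1)[OF arr_comp[OF e r]] arrD(1)[OF arr_comp[OF \<sigma> \<alpha>r]] arrD(1)[OF arr_comp[OF \<sigma> h]]
    have "\<tau> \<cdot> r \<oplus>\<^bsub>Hom C P P\<^esub> \<sigma> \<cdot> w
      = (e \<cdot> r \<ominus>\<^bsub>Hom C P P\<^esub> \<sigma> \<cdot> (\<alpha> \<cdot> r)) \<oplus>\<^bsub>Hom C P P\<^esub> (\<sigma> \<cdot> (\<alpha> \<cdot> r) \<oplus>\<^bsub>Hom C P P\<^esub> \<sigma> \<cdot> h)"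
      unfolding \<tau>_def diff_comp[OF e \<sigma>\<alpha> r] comp_assoc[OF \<sigma> \<alpha> r] w_def comp_add[OF \<sigma> \<alpha>r h] ..
    also have "\<dots> = e \<cdot> r \<oplus>\<^bsub>Hom C P P\<^esub> \<sigma> \<cdot> h"
      using cl H.diff_add_cancel[OF cl(2,1)]
      by (metis H.a_assoc H.minus_closed)
    finally show ?thesis using sum by simp
  qed
  have "push C Z \<tau> \<delta> = \<epsilon>"
  proof -
    interpret E: abelian_group "Ext C Z P" by (rule ext_group[OF u(3)])
    have x: "extn (push C Z (\<tau> \<cdot> r) \<epsilon>) Z P" using extn_push[OF \<tau>r u(3)] .
    have "\<epsilon> = push C Z (\<tau> \<cdot> r) \<epsilon> \<oplus>\<^bsub>Ext C Z P\<^esub> push C Z \<sigma> (push C Z w \<epsilon>)"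
      unfolding push_comp[OF \<sigma> w u(3), symmetric] push_add_arrow[OF \<tau>r \<sigma>w u(3), symmetric] \<tau>r_sum
        push_id[OF u(3)] ..
    also have "\<dots> = push C Z (\<tau> \<cdot> r) \<epsilon>"
      using w\<epsilon> push_zero[OF o(3) \<sigma>] extnD(1)[OF x] by (simp add: w_def)
    finally show ?thesis using push_comp[OF \<tau> r u(3)] r\<epsilon> by simp
  qed
  then have "push C Z \<tau> \<delta> = pull C P (Ident C Z) \<epsilon>" using pull_id[OF u(3)] by simp
  then obtain k where k: "arr k Y M" "k \<cdot> f = u \<cdot> \<tau>" "v \<cdot> k = g"
    using triangle_filler[OF t tP \<tau> arr_id[OF o(3)]] id_comp[OF a(2)] unfolding v_def by metis
  define \<phi> where "\<phi> = col C M Y X' b c"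
  have \<phi>: "arr \<phi> M (Y \<boxplus> X')" and p\<phi>: "pr1 C Y X' \<cdot> \<phi> = b" "pr2 C Y X' \<cdot> \<phi> = c"
    unfolding \<phi>_def by (rule col_simps[OF b(1) c(1)])+
  note i = arr_bip[OF o(2,4)]
  define \<psi> where "\<psi> = row C Y X' M k j"
  have \<psi>: "arr \<psi> (Y \<boxplus> X') M" unfolding \<psi>_def by (rule arr_row[OF k(1) j])
  note kb = arr_comp[OF k(1) b(1)] and jc = arr_comp[OF j c(1)] and \<psi>\<phi> = arr_comp[OF \<psi> \<phi>]
  have \<psi>\<phi>_sum: "\<psi> \<cdot> \<phi> = k \<cdot> b \<oplus>\<^bsub>Hom C M M\<^esub> j \<cdot> c"
    unfolding \<psi>_def row_comp[OF \<phi> k(1) j] p\<phi> ..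
  have "(\<psi> \<cdot> \<phi>) \<cdot> u = u"
  proof -
    have "(k \<cdot> b) \<cdot> u = u \<cdot> (\<tau> \<cdot> r)"
      unfolding comp_assoc[OF k(1) b(1) u(1)] b(2) comp_assoc[OF k(1) a(1) r, symmetric] k(2)
        comp_assoc[OF u(1) \<tau> r] ..
    moreover have "(j \<cdot> c) \<cdot> u = u \<cdot> (\<sigma> \<cdot> w)"
      using comp_assoc[OF j c(1) u(1)] comp_assoc[OF u(1) \<sigma> w] by (simp add: c(2)[symmetric] j_def)
    ultimately show ?thesis
      unfolding \<psi>\<phi>_sum add_comp[OF kb jc u(1)]
      using comp_add[OF u(1) \<tau>r \<sigma>w] \<tau>r_sum comp_id[OF u(1)] by simp
  qed
  moreover have "v \<cdot> (\<psi> \<cdot> \<phi>) = v"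
  proof -
    have "v \<cdot> j = \<zero>\<^bsub>Hom C X' Z\<^esub>"
      unfolding v_def comp_assoc[OF a'(2) n j] nj l_def comp_uminus[OF a'(2,1)] deflation_inflation[OF t']
      using abelian_group.uminus_zero Hom_abelian_group[OF o(4,3)] by blast
    then show ?thesis
      unfolding \<psi>\<phi>_sum comp_add[OF v kb jc] comp_assoc[OF v k(1) b(1), symmetric]
        comp_assoc[OF v j c(1), symmetric] k(3) b(3)
      using zero_comp[OF o(3) c(1)] hom_add_zero[OF v] by simp
  qed
  ultimately have "is_iso C (\<psi> \<cdot> \<phi>) M M"
    using middle_endomorphism_iso[OF tP \<psi>\<phi>] by (simp add: v_def)
  then obtain \<mu> where \<mu>: "arr \<mu> M M" "\<mu> \<cdot> (\<psi> \<cdot> \<phi>) = Ident C M" using is_isoE[OF _ M M] by metis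
  \<comment> \<open>So \<open>\<phi>\<close> has a left inverse. A right inverse arises by normalizing \<open>k\<close> to \<open>b k = 1\<close> and
    \<open>c k = 0\<close>.\<close>
  have bk: "arr (b \<cdot> k) Y Y" using arr_comp[OF b(1) k(1)] .
  have "r \<cdot> \<tau> = Ident C X"
    unfolding \<tau>_def comp_diff[OF r e \<sigma>\<alpha>] comp_assoc[OF r \<sigma> \<alpha>, symmetric] re r\<sigma> zero_comp[OF o(1) \<alpha>]
      hom_diff_zero[OF arr_id[OF o(1)]] ..
  then have "(b \<cdot> k) \<cdot> f = f"
    unfolding comp_assoc[OF b(1) k(1) a(1)] k(2) comp_assoc[OF b(1) u(1) \<tau>, symmetric] b(2)
      comp_assoc[OF a(1) r \<tau>] by (simp add: comp_id[OF a(1)])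
  moreover have "g \<cdot> (b \<cdot> k) = g"
    unfolding comp_assoc[OF a(2) b(1) k(1), symmetric] b(3) k(3) ..
  ultimately have "is_iso C (b \<cdot> k) Y Y" using middle_endomorphism_iso[OF t bk] by blast
  then obtain \<kappa> where \<kappa>: "arr \<kappa> Y Y" "(b \<cdot> k) \<cdot> \<kappa> = Ident C Y" using is_isoE[OF _ o(2) o(2)] by metis
  define k1 where "k1 = k \<cdot> \<kappa>"
  have k1: "arr k1 Y M" unfolding k1_def using arr_comp[OF k(1) \<kappa>(1)] .
  note ck1 = arr_comp[OF c(1) k1]
  note jck1 = arr_comp[OF j ck1]
  define k2 where "k2 = k1 \<ominus>\<^bsub>Hom C Y M\<^esub> j \<cdot> (c \<cdot> k1)"
  have k2: "arr k2 Y M" unfolding k2_def using arr_diff[OF k1 jck1] .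
  have bk1: "b \<cdot> k1 = Ident C Y" unfolding k1_def comp_assoc[OF b(1) k(1) \<kappa>(1), symmetric] \<kappa>(2) ..
  have bk2: "b \<cdot> k2 = Ident C Y"
    unfolding k2_def comp_diff[OF b(1) k1 jck1] comp_assoc[OF b(1) j ck1, symmetric] bk1 bj
      zero_comp[OF o(2) ck1] hom_diff_zero[OF arr_id[OF o(2)]] ..
  have ck2: "c \<cdot> k2 = \<zero>\<^bsub>Hom C Y X'\<^esub>"
    unfolding k2_def comp_diff[OF c(1) k1 jck1] comp_assoc[OF c(1) j ck1, symmetric] cj id_comp[OF ck1]
      hom_diff_self[OF ck1] ..
  have \<phi>k2: "\<phi> \<cdot> k2 = in1 C Y X'"
    using comp_assoc[OF i(3) \<phi> k2] comp_assoc[OF i(4) \<phi> k2] bk2 ck2 o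
    by (intro eq_to_bip[OF arr_comp[OF \<phi> k2] i(1) o(2,4)]) (simp_all add: p\<phi> pr1_in1 pr2_in1)
  have \<phi>j: "\<phi> \<cdot> j = in2 C Y X'"
    using comp_assoc[OF i(3) \<phi> j] comp_assoc[OF i(4) \<phi> j] bj cj o
    by (intro eq_to_bip[OF arr_comp[OF \<phi> j] i(2) o(2,4)]) (simp_all add: p\<phi> pr1_in2 pr2_in2)
  define \<psi>' where "\<psi>' = row C Y X' M k2 j"
  note \<psi>' = row_simps[OF k2 j, folded \<psi>'_def]
  note iB = arr_id[OF Bip_Obj[OF o(2,4)]]
  have "\<phi> \<cdot> \<psi>' = Ident C (Y \<boxplus> X')"
    using comp_assoc[OF \<phi> \<psi>'(1) i(1)] comp_assoc[OF \<phi> \<psi>'(1) i(2)]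
    by (intro eq_on_bip[OF arr_comp[OF \<phi> \<psi>'(1)] iB o(2,4)])
      (simp_all add: \<psi>'(2,3) \<phi>k2 \<phi>j id_comp[OF i(1)] id_comp[OF i(2)])
  then have iso: "is_iso C \<phi> M (Y \<boxplus> X')"
    using is_isoI[OF \<phi> arr_comp[OF \<mu>(1) \<psi>] _ \<psi>'(1)] comp_assoc[OF \<mu>(1) \<psi> \<phi>] \<mu>(2) by simp
  obtain \<chi> where \<chi>: "arr \<chi> (Y \<boxplus> X') M" "\<chi> \<cdot> \<phi> = Ident C M" "\<phi> \<cdot> \<chi> = Ident C (Y \<boxplus> X')"
    using is_isoE[OF iso M Bip_Obj[OF o(2,4)]] by metis
  define p where "p = n \<cdot> \<chi>"
  have p: "arr p (Y \<boxplus> X') Y'" unfolding p_def using arr_comp[OF n \<chi>(1)] .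
  have p\<phi>n: "p \<cdot> \<phi> = n"
    unfolding p_def comp_assoc[OF n \<chi>(1) \<phi>] \<chi>(2) comp_id[OF n] ..
  define \<beta> where "\<beta> = p \<cdot> in1 C Y X'"
  have \<beta>: "arr \<beta> Y Y'" unfolding \<beta>_def using arr_comp[OF p i(1)] .
  have "p \<cdot> in2 C Y X' = l"
    unfolding \<phi>j[symmetric] comp_assoc[OF p \<phi> j, symmetric] p\<phi>n nj ..
  then have p_row: "p = row C Y X' Y' \<beta> l"
    by (intro eq_on_bip[OF p arr_row[OF \<beta> l] o(2,4)])
      (simp_all add: row_in1[OF \<beta> l] row_in2[OF \<beta> l] \<beta>_def[symmetric])
  have m_arr: "arr m X M" using triangleD(1)[OF tM] .
  have \<phi>m: "\<phi> \<cdot> m = col C X Y X' f \<alpha>"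
    using comp_assoc[OF i(3) \<phi> m_arr, symmetric] comp_assoc[OF i(4) \<phi> m_arr, symmetric] bm cm
    by (intro eq_to_bip[OF arr_comp[OF \<phi> m_arr] arr_col[OF a(1) \<alpha>] o(2,4)])
      (simp_all add: p\<phi> pr1_col[OF a(1) \<alpha>] pr2_col[OF a(1) \<alpha>])
  have tri: "E_triangle C X (col C X Y X' f \<alpha>) (Y \<boxplus> X') (row C Y X' Y' \<beta> l) Y' (pull C X g' \<delta>)"
    using triangle_transport[OF tM iso Bip_Obj[OF o(2,4)] p p\<phi>n] \<phi>m p_row by simp
  have "g' \<cdot> \<beta> = g"
  proof -
    have vg: "v = (g \<cdot> pr1 C Y X') \<cdot> \<phi>" unfolding comp_assoc[OF a(2) i(3) \<phi>] p\<phi> b(3) ..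
    note gp = arr_comp[OF a(2) i(3)]
    have "g' \<cdot> p = g \<cdot> pr1 C Y X'"
      unfolding p_def comp_assoc[OF a'(2) n \<chi>(1), symmetric] v_def[symmetric] vg
        comp_assoc[OF gp \<phi> \<chi>(1)] \<chi>(3) comp_id[OF gp] ..
    then show ?thesis
      using comp_assoc[OF a'(2) p i(1)] comp_assoc[OF a(2) i(3,1)] o
      by (simp add: \<beta>_def pr1_in1 comp_id[OF a(2)])
  qed
  moreover have "\<beta> \<cdot> f = f' \<cdot> \<alpha>"
    using deflation_inflation[OF tri] row_col_defect[OF \<beta> a'(1) a(1) \<alpha>]
      eq_of_diff_zero[OF arr_comp[OF a'(1) \<alpha>] arr_comp[OF \<beta> a(1)]] by (simp add: l_def)
  ultimately show ?thesis using that[OF \<beta>] tri by (simp add: l_def)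
qed

end

section \<open>Exactness for an arbitrary morphism of E-triangles\<close>

context extriangulated_category
begin

context
  fixes X f Y g Z \<delta> X' f' Y' g' \<alpha> \<beta>
  assumes t: "E_triangle C X f Y g Z \<delta>" and t': "E_triangle C X' f' Y' g' Z (push C Z \<alpha> \<delta>)"
    and \<alpha>: "arr \<alpha> X X'" and \<beta>: "arr \<beta> Y Y'" and \<beta>f: "\<beta> \<cdot> f = f' \<cdot> \<alpha>" and g'\<beta>: "g' \<cdot> \<beta> = g"
begin

private abbreviation l where "l \<equiv> \<ominus>\<^bsub>Hom C X' Y'\<^esub> f'"
private abbreviation i where "i \<equiv> col C X Y X' f \<alpha>"
private abbreviation p where "p \<equiv> row C Y X' Y' \<beta> l"
private abbreviation \<eta> where "\<eta> \<equiv> pull C X g' \<delta>"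

private lemmas a = triangleD[OF t] and a' = triangleD[OF t']

private lemma o: "X \<in> Obj C" "Y \<in> Obj C" "Z \<in> Obj C" "X' \<in> Obj C" "Y' \<in> Obj C"
  using \<alpha> a a' by (auto simp: arr_def)

private lemma l: "arr l X' Y'"
  using arr_uminus[OF a'(1)] .

private lemmas b = arr_bip[OF o(2,4)]
private lemmas i = col_simps[OF a(1) \<alpha>] and p = row_simps[OF \<beta> l]

private lemma bip_obj: "Y \<boxplus> X' \<in> Obj C"
  using Bip_Obj[OF o(2,4)] .

private lemma g'l: "g' \<cdot> l = \<zero>\<^bsub>Hom C X' Z\<^esub>"
  unfolding comp_uminus[OF a'(2,1)] deflation_inflation[OF t']
  using abelian_group.uminus_zero Hom_abelian_group[OF o(4,3)] by blast

private lemma \<eta>: "extn \<eta> Y' X"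
  using extn_pull[OF a'(2) a(3)] .

private lemma pi: "p \<cdot> i = \<zero>\<^bsub>Hom C X Y'\<^esub>"
  unfolding row_col_defect[OF \<beta> a'(1) a(1) \<alpha>] \<beta>f hom_diff_self[OF arr_comp[OF a'(1) \<alpha>]] ..

private lemma pull_p: "pull C X p \<eta> = \<zero>\<^bsub>Ext C (Y \<boxplus> X') X\<^esub>"
proof (rule pull_bip_zero[OF extn_pull[OF p(1) \<eta>] o(2,4)])
  show "pull C X (in1 C Y X') (pull C X p \<eta>) = \<zero>\<^bsub>Ext C Y X\<^esub>"
    using pull_comp[OF p(1) b(1) \<eta>] pull_comp[OF a'(2) \<beta> a(3)] p(2) g'\<beta> pull_deflation[OF t] by simp
  show "pull C X (in2 C Y X') (pull C X p \<eta>) = \<zero>\<^bsub>Ext C X' X\<^esub>"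
    using pull_comp[OF p(1) b(2) \<eta>] pull_comp[OF a'(2) l a(3)] p(3) g'l pull_zero_arrow[OF a(3) o(4)]
    by simp
qed

private lemma push_i: "push C Y' i \<eta> = \<zero>\<^bsub>Ext C Y' (Y \<boxplus> X')\<^esub>"
proof (rule push_bip_zero[OF extn_push[OF i(1) \<eta>] o(2,4)])
  show "push C Y' (pr1 C Y X') (push C Y' i \<eta>) = \<zero>\<^bsub>Ext C Y' Y\<^esub>"
    using push_comp[OF b(3) i(1) \<eta>] push_pull[OF a(1) a'(2) a(3)] i(2) push_inflation[OF t]
      pull_zero[OF o(2) a'(2)] by simp
  show "push C Y' (pr2 C Y X') (push C Y' i \<eta>) = \<zero>\<^bsub>Ext C Y' X'\<^esub>"
    using push_comp[OF b(4) i(1) \<eta>] push_pull[OF \<alpha> a'(2) a(3)] i(3) pull_deflation[OF t'] by simp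
qed

text \<open>For \<open>\<psi> = (u, v)\<close> with \<open>u f + v \<alpha> = 0\<close> the map \<open>v\<close> extends along \<open>f'\<close>, because
  \<open>v\<^sub>* \<alpha>\<^sub>* \<delta> = - u\<^sub>* f\<^sub>* \<delta> = 0\<close>. The extension, negated to \<open>\<chi>1\<close>, yields \<open>u\<close> up to a map \<open>q g = q g' \<beta>\<close>;
  subtracting \<open>q g'\<close> corrects the first component and leaves the second one alone, as \<open>g' f' = 0\<close>.\<close>

lemma factor_through_row:
  assumes \<psi>: "arr \<psi> (Y \<boxplus> X') T" and z: "\<psi> \<cdot> i = \<zero>\<^bsub>Hom C X T\<^esub>"
  obtains \<chi> where "arr \<chi> Y' T" "\<psi> = \<chi> \<cdot> p"
proof -
  have T: "T \<in> Obj C" using \<psi> by (simp add: arr_def)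
  define u where "u = \<psi> \<cdot> in1 C Y X'"
  define v where "v = \<psi> \<cdot> in2 C Y X'"
  have u: "arr u Y T" and v: "arr v X' T"
    unfolding u_def v_def using arr_comp[OF \<psi> b(1)] arr_comp[OF \<psi> b(2)] .
  note uf = arr_comp[OF u a(1)] and v\<alpha> = arr_comp[OF v \<alpha>]
  have sum: "u \<cdot> f \<oplus>\<^bsub>Hom C X T\<^esub> v \<cdot> \<alpha> = \<zero>\<^bsub>Hom C X T\<^esub>"
    using z unfolding comp_col[OF \<psi> a(1) \<alpha>] u_def v_def .
  interpret H: abelian_group "Hom C X T" by (rule hom_group[OF uf])
  interpret H': abelian_group "Hom C X' T" by (rule hom_group[OF v])
  have uf_v\<alpha>: "\<ominus>\<^bsub>Hom C X T\<^esub> (v \<cdot> \<alpha>) = u \<cdot> f"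
    using H.minus_equality[OF sum] arrD(1)[OF uf] arrD(1)[OF v\<alpha>] by simp
  have "push C Z v (push C Z \<alpha> \<delta>) = \<zero>\<^bsub>Ext C Z T\<^esub>"
  proof -
    interpret E: abelian_group "Ext C Z T" using ext_group[OF extn_push[OF v\<alpha> a(3)]] .
    have "push C Z (u \<cdot> f) \<delta> \<oplus>\<^bsub>Ext C Z T\<^esub> push C Z (v \<cdot> \<alpha>) \<delta> = \<zero>\<^bsub>Ext C Z T\<^esub>"
      unfolding push_add_arrow[OF uf v\<alpha> a(3), symmetric] sum push_zero_arrow[OF a(3) T] ..
    moreover have "push C Z (u \<cdot> f) \<delta> = \<zero>\<^bsub>Ext C Z T\<^esub>"
      unfolding push_comp[OF u a(1,3)] push_inflation[OF t] push_zero[OF o(3) u] ..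
    ultimately show ?thesis
      using extnD(1)[OF extn_push[OF v\<alpha> a(3)]] push_comp[OF v \<alpha> a(3)] by simp
  qed
  then obtain \<chi>0 where \<chi>0: "arr \<chi>0 Y' T" "v = \<chi>0 \<cdot> f'" using extend_along_inflation[OF t' v] by blast
  define \<chi>1 where "\<chi>1 = \<ominus>\<^bsub>Hom C Y' T\<^esub> \<chi>0"
  have \<chi>1: "arr \<chi>1 Y' T" unfolding \<chi>1_def using arr_uminus[OF \<chi>0(1)] .
  have \<chi>1l: "\<chi>1 \<cdot> l = v"
    unfolding \<chi>1_def uminus_comp[OF \<chi>0(1) l] comp_uminus[OF \<chi>0(1) a'(1)] \<chi>0(2)[symmetric]
    using H'.minus_minus arrD(1)[OF v] by simp
  note \<chi>1\<beta> = arr_comp[OF \<chi>1 \<beta>]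
  have "(\<chi>1 \<cdot> \<beta>) \<cdot> f = u \<cdot> f"
    unfolding comp_assoc[OF \<chi>1 \<beta> a(1)] \<beta>f comp_assoc[OF \<chi>1 a'(1) \<alpha>, symmetric]
    unfolding \<chi>1_def uminus_comp[OF \<chi>0(1) a'(1)] \<chi>0(2)[symmetric] uminus_comp[OF v \<alpha>] uf_v\<alpha> ..
  then have "(\<chi>1 \<cdot> \<beta> \<ominus>\<^bsub>Hom C Y T\<^esub> u) \<cdot> f = \<zero>\<^bsub>Hom C X T\<^esub>"
    unfolding diff_comp[OF \<chi>1\<beta> u a(1)] by (simp add: hom_diff_self[OF uf])
  then obtain q where q: "arr q Z T" "\<chi>1 \<cdot> \<beta> \<ominus>\<^bsub>Hom C Y T\<^esub> u = q \<cdot> g"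
    using factor_through_deflation[OF t arr_diff[OF \<chi>1\<beta> u]] by blast
  note qg' = arr_comp[OF q(1) a'(2)]
  define \<chi> where "\<chi> = \<chi>1 \<ominus>\<^bsub>Hom C Y' T\<^esub> q \<cdot> g'"
  have \<chi>: "arr \<chi> Y' T" unfolding \<chi>_def using arr_diff[OF \<chi>1 qg'] .
  have "\<chi> \<cdot> \<beta> = u"
    unfolding \<chi>_def diff_comp[OF \<chi>1 qg' \<beta>] comp_assoc[OF q(1) a'(2) \<beta>] g'\<beta> q(2)[symmetric]
      hom_diff_diff_cancel[OF u \<chi>1\<beta>] ..
  moreover have "\<chi> \<cdot> l = v"
    unfolding \<chi>_def diff_comp[OF \<chi>1 qg' l] comp_assoc[OF q(1) a'(2) l] g'l \<chi>1l comp_zero[OF o(4) q(1)]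
      hom_diff_zero[OF v] ..
  ultimately have "\<psi> = \<chi> \<cdot> p"
    using comp_assoc[OF \<chi> p(1) b(1)] comp_assoc[OF \<chi> p(1) b(2)] p(2,3)
    by (intro eq_on_bip[OF \<psi> arr_comp[OF \<chi> p(1)] o(2,4)]) (simp_all add: u_def v_def)
  with \<chi> show ?thesis using that by blast
qed

lemma contravariant_sequence_exact:
  assumes T: "T \<in> Obj C"
  shows "exact_six
      (Hom C Y' T) (\<lambda>\<psi>. \<psi> \<cdot> p) (Hom C (Y \<boxplus> X') T) (\<lambda>\<psi>. \<psi> \<cdot> i) (Hom C X T)
      (\<lambda>\<psi>. push C Y' \<psi> \<eta>) (Ext C Y' T) (pull C T p) (Ext C (Y \<boxplus> X') T) (pull C T i) (Ext C X T)"
  unfolding exact_six_def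
proof (intro conjI exact_atI)
  show "abelian_group_hom (Hom C Y' T) (Hom C (Y \<boxplus> X') T) (\<lambda>\<psi>. \<psi> \<cdot> p)"
    by (rule precomp_hom[OF T p(1)])
  show "abelian_group_hom (Hom C (Y \<boxplus> X') T) (Hom C X T) (\<lambda>\<psi>. \<psi> \<cdot> i)" (is ?h2)
    by (rule precomp_hom[OF T i(1)])
  then show ?h2 .
  show "abelian_group_hom (Hom C X T) (Ext C Y' T) (\<lambda>\<psi>. push C Y' \<psi> \<eta>)" (is ?h3)
    by (rule push_along_hom[OF \<eta> T])
  then show ?h3 .
  show "abelian_group_hom (Ext C Y' T) (Ext C (Y \<boxplus> X') T) (pull C T p)" (is ?h4)
    by (rule pull_hom[OF T p(1)])
  then show ?h4 .
  show "abelian_group_hom (Ext C (Y \<boxplus> X') T) (Ext C X T) (pull C T i)"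
    by (rule pull_hom[OF T i(1)])
next
  fix \<psi> assume "\<psi> \<in> carrier (Hom C Y' T)"
  then have \<psi>: "arr \<psi> Y' T" using o T by (simp add: arr_def)
  show "(\<psi> \<cdot> p) \<cdot> i = \<zero>\<^bsub>Hom C X T\<^esub>"
    unfolding comp_assoc[OF \<psi> p(1) i(1)] pi comp_zero[OF o(1) \<psi>] ..
next
  fix \<psi> assume "\<psi> \<in> carrier (Hom C (Y \<boxplus> X') T)"
  then have \<psi>: "arr \<psi> (Y \<boxplus> X') T" using bip_obj T by (simp add: arr_def)
  show "push C Y' (\<psi> \<cdot> i) \<eta> = \<zero>\<^bsub>Ext C Y' T\<^esub>"
    unfolding push_comp[OF \<psi> i(1) \<eta>] push_i push_zero[OF o(5) \<psi>] ..
  assume "\<psi> \<cdot> i = \<zero>\<^bsub>Hom C X T\<^esub>"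
  then obtain \<chi> where "arr \<chi> Y' T" "\<psi> = \<chi> \<cdot> p" using factor_through_row[OF \<psi>] by blast
  then show "\<exists>\<chi>\<in>carrier (Hom C Y' T). \<psi> = \<chi> \<cdot> p" using arrD(1) by blast
next
  fix \<psi> assume "\<psi> \<in> carrier (Hom C X T)"
  then have \<psi>: "arr \<psi> X T" using o T by (simp add: arr_def)
  show "pull C T p (push C Y' \<psi> \<eta>) = \<zero>\<^bsub>Ext C (Y \<boxplus> X') T\<^esub>"
    unfolding push_pull[OF \<psi> p(1) \<eta>, symmetric] pull_p push_zero[OF bip_obj \<psi>] ..
  assume "push C Y' \<psi> \<eta> = \<zero>\<^bsub>Ext C Y' T\<^esub>"
  then have "pull C T g' (push C Z \<psi> \<delta>) = \<zero>\<^bsub>Ext C Y' T\<^esub>" using push_pull[OF \<psi> a'(2) a(3)] by simp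
  then obtain v where v: "arr v X' T" "push C Z \<psi> \<delta> = push C Z v (push C Z \<alpha> \<delta>)"
    using extension_killed_by_deflation[OF t' extn_push[OF \<psi> a(3)]] by blast
  note v\<alpha> = arr_comp[OF v(1) \<alpha>]
  have "push C Z (\<psi> \<ominus>\<^bsub>Hom C X T\<^esub> v \<cdot> \<alpha>) \<delta> = \<zero>\<^bsub>Ext C Z T\<^esub>"
    unfolding push_diff_arrow[OF \<psi> v\<alpha> a(3)] push_comp[OF v(1) \<alpha> a(3)] v(2)
    using ext_diff_self[OF extn_push[OF v(1) a'(3)]] .
  then obtain u where u: "arr u Y T" "\<psi> \<ominus>\<^bsub>Hom C X T\<^esub> v \<cdot> \<alpha> = u \<cdot> f"
    using extend_along_inflation[OF t arr_diff[OF \<psi> v\<alpha>]] by blast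
  have "row C Y X' T u v \<cdot> i = \<psi>"
    unfolding comp_col[OF arr_row[OF u(1) v(1)] a(1) \<alpha>] row_in1[OF u(1) v(1)] row_in2[OF u(1) v(1)]
      u(2)[symmetric] hom_diff_add_cancel[OF v\<alpha> \<psi>] ..
  then show "\<exists>\<chi>\<in>carrier (Hom C (Y \<boxplus> X') T). \<psi> = \<chi> \<cdot> i"
    using arrD(1)[OF arr_row[OF u(1) v(1)]] by blast
next
  fix \<theta> assume "\<theta> \<in> carrier (Ext C Y' T)"
  then have \<theta>: "extn \<theta> Y' T" using o T by (simp add: extn_def)
  show "pull C T i (pull C T p \<theta>) = \<zero>\<^bsub>Ext C X T\<^esub>"
    unfolding pull_comp[OF p(1) i(1) \<theta>, symmetric] pi pull_zero_arrow[OF \<theta> o(1)] ..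
  assume z: "pull C T p \<theta> = \<zero>\<^bsub>Ext C (Y \<boxplus> X') T\<^esub>"
  have z1: "pull C T \<beta> \<theta> = \<zero>\<^bsub>Ext C Y T\<^esub>"
    using pull_comp[OF p(1) b(1) \<theta>] z pull_zero[OF T b(1)] p(2) by simp
  have z2: "pull C T l \<theta> = \<zero>\<^bsub>Ext C X' T\<^esub>"
    using pull_comp[OF p(1) b(2) \<theta>] z pull_zero[OF T b(2)] p(3) by simp
  have "pull C T f' \<theta> = \<zero>\<^bsub>Ext C X' T\<^esub>"
  proof -
    note x = extn_pull[OF a'(1) \<theta>]
    interpret E: abelian_group "Ext C X' T" by (rule ext_group[OF x])
    show ?thesis
      using z2 E.minus_minus[OF extnD(1)[OF x]] E.uminus_zero by (simp add: pull_uminus_arrow[OF a'(1) \<theta>])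
  qed
  then obtain \<sigma> where \<sigma>: "extn \<sigma> Z T" "\<theta> = pull C T g' \<sigma>"
    using extension_of_middle_from_third[OF t' \<theta>] by blast
  have "pull C T g \<sigma> = \<zero>\<^bsub>Ext C Y T\<^esub>" using pull_comp[OF a'(2) \<beta> \<sigma>(1)] z1 \<sigma>(2) g'\<beta> by simp
  then obtain \<psi> where \<psi>: "arr \<psi> X T" "\<sigma> = push C Z \<psi> \<delta>"
    using extension_killed_by_deflation[OF t \<sigma>(1)] by blast
  then have "\<theta> = push C Y' \<psi> \<eta>" using push_pull[OF \<psi>(1) a'(2) a(3)] \<sigma>(2) by simp
  then show "\<exists>\<psi>\<in>carrier (Hom C X T). \<theta> = push C Y' \<psi> \<eta>" using arrD(1)[OF \<psi>(1)] by blast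
next
  fix \<sigma> assume "\<sigma> \<in> carrier (Ext C (Y \<boxplus> X') T)" and z: "pull C T i \<sigma> = \<zero>\<^bsub>Ext C X T\<^esub>"
  then have \<sigma>: "extn \<sigma> (Y \<boxplus> X') T" using bip_obj T by (simp add: extn_def)
  \<comment> \<open>Here the two original E-triangles give no information, and the one through the biproduct is
    used. Its row may belong to a different \<open>\<beta>\<close>, but it factors through \<open>p\<close>.\<close>
  obtain \<beta>0 where \<beta>0: "arr \<beta>0 Y Y'" and t0: "E_triangle C X i (Y \<boxplus> X') (row C Y X' Y' \<beta>0 l) Y' \<eta>"
    using homotopy_pullback[OF t t' \<alpha>] by blast
  obtain \<theta> where \<theta>: "extn \<theta> Y' T" "\<sigma> = pull C T (row C Y X' Y' \<beta>0 l) \<theta>"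
    using extension_of_middle_from_third[OF t0 \<sigma> z] by blast
  obtain c where c: "arr c Y' Y'" "row C Y X' Y' \<beta>0 l = c \<cdot> p"
    using factor_through_row[OF arr_row[OF \<beta>0 l] deflation_inflation[OF t0]] by blast
  have "\<sigma> = pull C T p (pull C T c \<theta>)" using pull_comp[OF c(1) p(1) \<theta>(1)] c(2) \<theta>(2) by simp
  then show "\<exists>\<theta>\<in>carrier (Ext C Y' T). \<sigma> = pull C T p \<theta>"
    using extnD(1)[OF extn_pull[OF c(1) \<theta>(1)]] by blast
qed

text \<open>Only the outer two places need an E-triangle on \<open>i\<close> and \<open>p\<close>, and its extension \<open>\<eta>'\<close> may differ
  from \<open>\<eta>\<close>; at the two places where \<open>\<eta>\<close> occurs a chase through the original E-triangles suffices.\<close>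

lemma covariant_sequence_exact:
  assumes t1: "E_triangle C X i (Y \<boxplus> X') p Y' \<eta>'" and T: "T \<in> Obj C"
  shows "exact_six
      (Hom C T X) (\<lambda>\<phi>. i \<cdot> \<phi>) (Hom C T (Y \<boxplus> X')) (\<lambda>\<phi>. p \<cdot> \<phi>) (Hom C T Y')
      (\<lambda>\<phi>. pull C X \<phi> \<eta>) (Ext C T X) (push C T i) (Ext C T (Y \<boxplus> X')) (push C T p) (Ext C T Y')"
  unfolding exact_six_def
proof (intro conjI exact_atI)
  show "abelian_group_hom (Hom C T X) (Hom C T (Y \<boxplus> X')) (\<lambda>\<phi>. i \<cdot> \<phi>)"
    by (rule postcomp_hom[OF T i(1)])
  show "abelian_group_hom (Hom C T (Y \<boxplus> X')) (Hom C T Y') (\<lambda>\<phi>. p \<cdot> \<phi>)" (is ?h2)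
    by (rule postcomp_hom[OF T p(1)])
  then show ?h2 .
  show "abelian_group_hom (Hom C T Y') (Ext C T X) (\<lambda>\<phi>. pull C X \<phi> \<eta>)" (is ?h3)
    by (rule pull_along_hom[OF \<eta> T])
  then show ?h3 .
  show "abelian_group_hom (Ext C T X) (Ext C T (Y \<boxplus> X')) (push C T i)" (is ?h4)
    by (rule push_hom[OF T i(1)])
  then show ?h4 .
  show "abelian_group_hom (Ext C T (Y \<boxplus> X')) (Ext C T Y') (push C T p)"
    by (rule push_hom[OF T p(1)])
next
  fix \<phi> assume "\<phi> \<in> carrier (Hom C T X)"
  then have \<phi>: "arr \<phi> T X" using o T by (simp add: arr_def)
  show "p \<cdot> (i \<cdot> \<phi>) = \<zero>\<^bsub>Hom C T Y'\<^esub>"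
    unfolding comp_assoc[OF p(1) i(1) \<phi>, symmetric] pi zero_comp[OF o(5) \<phi>] ..
next
  fix \<phi> assume "\<phi> \<in> carrier (Hom C T (Y \<boxplus> X'))"
  then have \<phi>: "arr \<phi> T (Y \<boxplus> X')" using bip_obj T by (simp add: arr_def)
  show "pull C X (p \<cdot> \<phi>) \<eta> = \<zero>\<^bsub>Ext C T X\<^esub>"
    unfolding pull_comp[OF p(1) \<phi> \<eta>] pull_p pull_zero[OF o(1) \<phi>] ..
  assume "p \<cdot> \<phi> = \<zero>\<^bsub>Hom C T Y'\<^esub>"
  then obtain \<chi> where "arr \<chi> T X" "\<phi> = i \<cdot> \<chi>" using factor_through_inflation[OF t1 \<phi>] by blast
  then show "\<exists>\<chi>\<in>carrier (Hom C T X). \<phi> = i \<cdot> \<chi>" using arrD(1) by blast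
next
  fix \<phi> assume "\<phi> \<in> carrier (Hom C T Y')"
  then have \<phi>: "arr \<phi> T Y'" using o T by (simp add: arr_def)
  show "push C T i (pull C X \<phi> \<eta>) = \<zero>\<^bsub>Ext C T (Y \<boxplus> X')\<^esub>"
    unfolding push_pull[OF i(1) \<phi> \<eta>] push_i pull_zero[OF bip_obj \<phi>] ..
  assume z: "pull C X \<phi> \<eta> = \<zero>\<^bsub>Ext C T X\<^esub>"
  note g'\<phi> = arr_comp[OF a'(2) \<phi>]
  obtain y where y: "arr y T Y" "g' \<cdot> \<phi> = g \<cdot> y"
    using lift_along_deflation[OF t g'\<phi>] z pull_comp[OF a'(2) \<phi> a(3)] by metis
  note \<beta>y = arr_comp[OF \<beta> y(1)]
  have "g' \<cdot> (\<phi> \<ominus>\<^bsub>Hom C T Y'\<^esub> \<beta> \<cdot> y) = \<zero>\<^bsub>Hom C T Z\<^esub>"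
    unfolding comp_diff[OF a'(2) \<phi> \<beta>y] comp_assoc[OF a'(2) \<beta> y(1), symmetric] g'\<beta> y(2)
      hom_diff_self[OF arr_comp[OF a(2) y(1)]] ..
  then obtain x where x: "arr x T X'" "\<phi> \<ominus>\<^bsub>Hom C T Y'\<^esub> \<beta> \<cdot> y = f' \<cdot> x"
    using factor_through_inflation[OF t' arr_diff[OF \<phi> \<beta>y]] by blast
  note mx = arr_uminus[OF x(1)]
  note col = col_simps[OF y(1) mx]
  have "l \<cdot> (\<ominus>\<^bsub>Hom C T X'\<^esub> x) = f' \<cdot> x"
  proof -
    note f'x = arr_comp[OF a'(1) x(1)]
    interpret H: abelian_group "Hom C T Y'" by (rule hom_group[OF f'x])
    show ?thesis
      unfolding uminus_comp[OF a'(1) mx] comp_uminus[OF a'(1) x(1)]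
      using H.minus_minus[OF arrD(1)[OF f'x]] .
  qed
  then have "p \<cdot> col C T Y X' y (\<ominus>\<^bsub>Hom C T X'\<^esub> x) = \<phi>"
    unfolding row_comp[OF col(1) \<beta> l] col(2,3) using hom_add_diff_cancel[OF \<beta>y \<phi>] x(2) by simp
  then show "\<exists>\<chi>\<in>carrier (Hom C T (Y \<boxplus> X')). \<phi> = p \<cdot> \<chi>" using arrD(1)[OF col(1)] by blast
next
  fix \<rho> assume "\<rho> \<in> carrier (Ext C T X)"
  then have \<rho>: "extn \<rho> T X" using o T by (simp add: extn_def)
  show "push C T p (push C T i \<rho>) = \<zero>\<^bsub>Ext C T Y'\<^esub>"
    unfolding push_comp[OF p(1) i(1) \<rho>, symmetric] pi push_zero_arrow[OF \<rho> o(5)] ..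
  assume z: "push C T i \<rho> = \<zero>\<^bsub>Ext C T (Y \<boxplus> X')\<^esub>"
  have z1: "push C T f \<rho> = \<zero>\<^bsub>Ext C T Y\<^esub>"
    using push_comp[OF b(3) i(1) \<rho>] z push_zero[OF T b(3)] i(2) by simp
  have z2: "push C T \<alpha> \<rho> = \<zero>\<^bsub>Ext C T X'\<^esub>"
    using push_comp[OF b(4) i(1) \<rho>] z push_zero[OF T b(4)] i(3) by simp
  obtain \<zeta> where \<zeta>: "arr \<zeta> T Z" "\<rho> = pull C X \<zeta> \<delta>"
    using extension_killed_by_inflation[OF t \<rho> z1] by blast
  have "pull C X' \<zeta> (push C Z \<alpha> \<delta>) = \<zero>\<^bsub>Ext C T X'\<^esub>"
    using push_pull[OF \<alpha> \<zeta>(1) a(3)] z2 \<zeta>(2) by simp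
  then obtain \<phi> where \<phi>: "arr \<phi> T Y'" "\<zeta> = g' \<cdot> \<phi>" using lift_along_deflation[OF t' \<zeta>(1)] by blast
  have "\<rho> = pull C X \<phi> \<eta>" using pull_comp[OF a'(2) \<phi>(1) a(3)] \<phi>(2) \<zeta>(2) by simp
  then show "\<exists>\<phi>\<in>carrier (Hom C T Y'). \<rho> = pull C X \<phi> \<eta>" using arrD(1)[OF \<phi>(1)] by blast
next
  fix \<sigma> assume "\<sigma> \<in> carrier (Ext C T (Y \<boxplus> X'))" and z: "push C T p \<sigma> = \<zero>\<^bsub>Ext C T Y'\<^esub>"
  then have \<sigma>: "extn \<sigma> T (Y \<boxplus> X')" using bip_obj T by (simp add: extn_def)
  obtain \<rho> where "extn \<rho> T X" "\<sigma> = push C T i \<rho>" using extension_of_middle_from_first[OF t1 \<sigma> z] by blast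
  then show "\<exists>\<rho>\<in>carrier (Ext C T X). \<sigma> = push C T i \<rho>" using extnD(1) by blast
qed

end

end

section \<open>Hom-finiteness and nilpotent corrections\<close>

text \<open>Otherwise all finite blocks of consecutive terms would be linearly independent, as one sees by
  extending a block at its left end; this contradicts finite dimension.\<close>

lemma (in vectorspace) sequence_term_in_span_of_later_terms:
  assumes "fin_dim" and x: "\<And>n::nat. x n \<in> carrier V"
  shows "\<exists>m N. x m \<in> span (x ` {m<..N})"
proof (rule ccontr)
  assume neg: "\<not> ?thesis"
  have li: "lin_indpt (x ` {m<..m + n}) \<and> card (x ` {m<..m + n}) = n" for m n
  proof (induction n arbitrary: m)
    case 0
    then show ?case by (auto simp: lin_dep_def)
  next
    case (Suc n)
    define S where "S = x ` {Suc m<..Suc m + n}"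
    have S: "S \<subseteq> carrier V" "lin_indpt S" "card S = n" "finite S"
      using Suc.IH[of "Suc m"] x by (auto simp: S_def)
    have "x (Suc m) \<notin> span S" using neg by (auto simp: S_def)
    then have "x (Suc m) \<notin> S" "lin_indpt (S \<union> {x (Suc m)})"
      using in_own_span[OF S(1)] lin_dep_iff_in_span[OF S(1,2) x] by auto
    moreover have "{m<..m + Suc n} = insert (Suc m) {Suc m<..Suc m + n}" by auto
    then have "x ` {m<..m + Suc n} = S \<union> {x (Suc m)}" by (simp add: S_def)
    ultimately show ?case using S(3,4) by simp
  qed
  have "x ` {0<..0 + Suc dim} \<subseteq> carrier V" using x by auto
  then have "card (x ` {0<..0 + Suc dim}) \<le> dim" using li_le_dim(2)[OF assms(1)] li[of 0 "Suc dim"] by blast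
  then show False using li[of 0 "Suc dim"] by simp
qed

context ring
begin

lemma one_minus_nilpotent_invertible:
  assumes a: "a \<in> carrier R" and n: "a [^] (n::nat) = \<zero>"
  obtains u where "u \<in> carrier R" "(\<one> \<ominus> a) \<otimes> u = \<one>" "u \<otimes> (\<one> \<ominus> a) = \<one>"
proof -
  have "\<exists>u\<in>carrier R. (\<one> \<ominus> a) \<otimes> u = \<one> \<ominus> a [^] k \<and> u \<otimes> (\<one> \<ominus> a) = \<one> \<ominus> a [^] k" for k :: nat
  proof (induction k)
    case 0
    then show ?case using a by (intro bexI[of _ \<zero>]) (simp_all add: diff_self)
  next
    case (Suc k)
    then obtain u where u: "u \<in> carrier R" "(\<one> \<ominus> a) \<otimes> u = \<one> \<ominus> a [^] k"
        "u \<otimes> (\<one> \<ominus> a) = \<one> \<ominus> a [^] k"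
      by blast
    define b where "b = a [^] k"
    have b: "b \<in> carrier R" "a \<otimes> b = a [^] Suc k" "b \<otimes> a = a [^] Suc k"
      using a nat_pow_Suc2[OF a] by (simp_all add: b_def)
    have tele: "(\<one> \<ominus> b) \<oplus> (b \<ominus> a [^] Suc k) = \<one> \<ominus> a [^] Suc k"
      using a b(1) by (simp add: minus_eq a_assoc r_neg2 r_neg1)
    have "(\<one> \<ominus> a) \<otimes> b = b \<ominus> a [^] Suc k" "b \<otimes> (\<one> \<ominus> a) = b \<ominus> a [^] Suc k"
      using a b by (simp_all add: minus_eq l_distr r_distr l_minus r_minus)
    then have "(\<one> \<ominus> a) \<otimes> (u \<oplus> b) = \<one> \<ominus> a [^] Suc k" "(u \<oplus> b) \<otimes> (\<one> \<ominus> a) = \<one> \<ominus> a [^] Suc k"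
      using a b(1) u tele by (simp_all add: r_distr l_distr b_def)
    then show ?case using u(1) b(1) by blast
  qed
  from this[of n] n that show ?thesis by (auto simp: diff_zero)
qed

text \<open>If the powers of \<open>a\<close> stabilize in this sense, \<open>1 - v a\<close> annihilates \<open>a\<^sup>m\<close>. In
  terms of Fitting's decomposition, \<open>1 - v a\<close> vanishes on the part on which \<open>a\<close> is invertible, so that
  only the nilpotent part of \<open>a\<close> survives.\<close>

lemma nilpotent_correction:
  assumes a: "a \<in> carrier R" and v: "v \<in> carrier R" and c: "a \<otimes> v = v \<otimes> a"
    and m: "a [^] (m::nat) = a [^] Suc m \<otimes> v"
  shows "(a \<otimes> (\<one> \<ominus> v \<otimes> a)) [^] Suc m = \<zero>"
proof -
  define w where "w = \<one> \<ominus> v \<otimes> a"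
  have w: "w \<in> carrier R" using a v by (simp add: w_def)
  have aw: "a \<otimes> w = w \<otimes> a"
    using a v c by (simp add: w_def minus_eq l_distr r_distr l_minus r_minus m_assoc[symmetric])
  have "a [^] m \<otimes> w = a [^] m \<ominus> a [^] Suc m \<otimes> v"
    using a v c by (simp add: w_def minus_eq r_distr r_minus m_assoc)
  then have "a [^] m \<otimes> w = \<zero>" using a m[symmetric] by (simp add: diff_self)
  moreover have "(a \<otimes> w) [^] Suc m = a \<otimes> ((a [^] m \<otimes> w) \<otimes> w [^] m)"
    unfolding pow_mult_distrib[OF aw a w] nat_pow_Suc2[OF a] nat_pow_Suc2[OF w]
    using a w by (simp add: m_assoc)
  ultimately show ?thesis using a w by (simp add: w_def)
qed

end

definition endo :: "('o, 'm, 'z) additive_cat_scheme \<Rightarrow> 'o \<Rightarrow> 'm ring" where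
  "endo C X = (Hom C X X)\<lparr>mult := Comp C, one := Ident C X\<rparr>"

lemma endo_simps [simp]:
  "carrier (endo C X) = carrier (Hom C X X)" "x \<otimes>\<^bsub>endo C X\<^esub> y = x \<cdot>\<^bsub>C\<^esub> y" "\<one>\<^bsub>endo C X\<^esub> = Ident C X"
  "x \<oplus>\<^bsub>endo C X\<^esub> y = x \<oplus>\<^bsub>Hom C X X\<^esub> y" "\<zero>\<^bsub>endo C X\<^esub> = \<zero>\<^bsub>Hom C X X\<^esub>"
  "x \<ominus>\<^bsub>endo C X\<^esub> y = x \<ominus>\<^bsub>Hom C X X\<^esub> y"
  by (simp_all add: endo_def a_minus_def a_inv_def)

context preadditive_category
begin

lemma endo_ring:
  assumes X: "X \<in> Obj C"
  shows "ring (endo C X)"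
proof -
  interpret H: abelian_group "Hom C X X" by (rule Hom_abelian_group[OF X X])
  show ?thesis
  proof (rule ringI)
    show "abelian_group (endo C X)"
    proof (rule abelian_groupI)
      fix x assume "x \<in> carrier (endo C X)"
      then show "\<exists>y\<in>carrier (endo C X). y \<oplus>\<^bsub>endo C X\<^esub> x = \<zero>\<^bsub>endo C X\<^esub>"
        using H.l_neg by (intro bexI[of _ "\<ominus>\<^bsub>Hom C X X\<^esub> x"]) simp_all
    qed (simp_all add: H.a_ac)
    show "monoid (endo C X)"
      by (rule monoidI)
        (use X in \<open>auto simp: Ident_mor Comp_Ident Ident_Comp intro: Comp_mor Comp_assoc\<close>)
  qed (use X in \<open>auto simp: Comp_add_left Comp_add_right\<close>)
qed

end

context linear_category
begin

text \<open>The multiples \<open>r\<^sup>m\<^sup>+\<^sup>1 v\<close> with \<open>v\<close> commuting with \<open>r\<close> form a subspace containing all higher powers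
  of \<open>r\<close>, and some \<open>r\<^sup>m\<close> lies in the span of these. Commutation of \<open>v\<close> with \<open>r\<close> is what makes
  \<open>r (1 - v r)\<close> nilpotent later on.\<close>

lemma endomorphism_power_stabilizes:
  assumes fin: "hom_finite C K scal" and Z: "Z \<in> Obj C" and r: "is_mor C r Z Z"
  obtains m :: nat and v where "is_mor C v Z Z" "r \<cdot> v = v \<cdot> r"
    "r [^]\<^bsub>endo C Z\<^esub> m = r [^]\<^bsub>endo C Z\<^esub> Suc m \<cdot> v"
proof -
  define V where "V = hom_space C scal Z Z"
  have V: "carrier V = carrier (Hom C Z Z)" "\<And>x y. x \<oplus>\<^bsub>V\<^esub> y = x \<oplus>\<^bsub>Hom C Z Z\<^esub> y" "\<zero>\<^bsub>V\<^esub> = \<zero>\<^bsub>Hom C Z Z\<^esub>"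
      "\<And>a x. a \<odot>\<^bsub>V\<^esub> x = scal a x"
    by (simp_all add: V_def hom_space_def ring.defs)
  interpret V: vectorspace K V unfolding V_def by (rule hom_vectorspace[OF Z Z])
  interpret E: ring "endo C Z" by (rule endo_ring[OF Z])
  have pow: "is_mor C (r [^]\<^bsub>endo C Z\<^esub> n) Z Z" for n :: nat
    using E.nat_pow_closed[of r n] r by simp
  have "V.fin_dim" using fin Z unfolding hom_finite_def V_def by blast
  then have "\<exists>(m::nat) N. r [^]\<^bsub>endo C Z\<^esub> m \<in> V.span ((\<lambda>n. r [^]\<^bsub>endo C Z\<^esub> n) ` {m<..N})"
    by (rule V.sequence_term_in_span_of_later_terms) (simp add: V(1) pow)
  then obtain m N :: nat
    where mN: "r [^]\<^bsub>endo C Z\<^esub> m \<in> V.span ((\<lambda>n. r [^]\<^bsub>endo C Z\<^esub> n) ` {m<..N})"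
    by blast
  define q where "q = r [^]\<^bsub>endo C Z\<^esub> Suc m"
  have q: "is_mor C q Z Z" unfolding q_def by (rule pow)
  define S where "S = {q \<cdot> v | v. is_mor C v Z Z \<and> r \<cdot> v = v \<cdot> r}"
  have "submodule K S V"
  proof (rule submodule.intro)
    show "module K V" by (rule V.module_axioms)
    show "S \<subseteq> carrier V" using q Z by (auto simp: S_def V intro: Comp_mor)
    show "\<zero>\<^bsub>V\<^esub> \<in> S"
      using E.r_null[of q] E.r_null[of r] E.l_null[of r] E.zero_closed q r unfolding S_def V by force
    fix x y c assume "x \<in> S"
    then obtain v where v: "x = q \<cdot> v" "is_mor C v Z Z" "r \<cdot> v = v \<cdot> r" by (auto simp: S_def)
    { assume c: "c \<in> carrier K"
      have "is_mor C (scal c v) Z Z" using V.smult_closed[OF c] v(2) by (simp add: V)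
      moreover have "r \<cdot> scal c v = scal c v \<cdot> r"
        using Comp_scal_left[OF Z Z Z r v(2) c] Comp_scal_right[OF Z Z Z v(2) r c] v(3) by simp
      moreover have "c \<odot>\<^bsub>V\<^esub> x = q \<cdot> scal c v" using Comp_scal_right[OF Z Z Z v(2) q c] v(1) by (simp add: V)
      ultimately show "c \<odot>\<^bsub>V\<^esub> x \<in> S" by (auto simp: S_def) }
    assume "y \<in> S"
    then obtain v' where v': "y = q \<cdot> v'" "is_mor C v' Z Z" "r \<cdot> v' = v' \<cdot> r" by (auto simp: S_def)
    have "is_mor C (v \<oplus>\<^bsub>Hom C Z Z\<^esub> v') Z Z" using E.a_closed[of v v'] v(2) v'(2) by simp
    moreover have "r \<cdot> (v \<oplus>\<^bsub>Hom C Z Z\<^esub> v') = (v \<oplus>\<^bsub>Hom C Z Z\<^esub> v') \<cdot> r"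
      using v v' r Z by (simp add: Comp_add_left Comp_add_right)
    moreover have "x \<oplus>\<^bsub>V\<^esub> y = q \<cdot> (v \<oplus>\<^bsub>Hom C Z Z\<^esub> v')" using v v' q Z by (simp add: V Comp_add_right)
    ultimately show "x \<oplus>\<^bsub>V\<^esub> y \<in> S" by (auto simp: S_def)
  qed
  moreover have "(\<lambda>n. r [^]\<^bsub>endo C Z\<^esub> n) ` {m<..N} \<subseteq> S"
  proof
    fix x assume "x \<in> (\<lambda>n. r [^]\<^bsub>endo C Z\<^esub> n) ` {m<..N}"
    then obtain n where n: "m < n" "x = r [^]\<^bsub>endo C Z\<^esub> n" by auto
    have "x = q \<cdot> r [^]\<^bsub>endo C Z\<^esub> (n - Suc m)"
      using E.nat_pow_mult[of r "Suc m" "n - Suc m"] r n by (simp add: q_def del: E.nat_pow_Suc)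
    moreover have "r \<cdot> r [^]\<^bsub>endo C Z\<^esub> k = r [^]\<^bsub>endo C Z\<^esub> k \<cdot> r" for k :: nat
      using E.nat_pow_Suc2[of r k] E.nat_pow_Suc[of r k] r by simp
    ultimately show "x \<in> S" using pow by (auto simp: S_def)
  qed
  ultimately have "r [^]\<^bsub>endo C Z\<^esub> m \<in> S" using V.span_is_subset mN by blast
  then show ?thesis using that by (auto simp: S_def q_def)
qed

end

context extriangulated_category
begin

text \<open>The given \<open>\<beta>\<close> differs from the \<open>\<beta>0\<close> of the homotopy pullback by some \<open>s g\<close>, and
  \<open>\<beta> = (1 - s g') \<beta>0\<close>. The E-triangle for \<open>\<beta>0\<close> can be moved to \<open>\<beta>\<close> when \<open>1 - s g'\<close> is invertible,
  for instance when \<open>g' s\<close> is nilpotent. This can fail for a bad \<open>s\<close>, but \<open>s\<close> may be replaced by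
  \<open>s w\<close> for every \<open>w\<close> with \<open>w g = g\<close>. As \<open>r = g' s\<close> satisfies \<open>r g = 0\<close>, one may take \<open>w = 1 - v r\<close>
  for any \<open>v\<close>, and \<open>v\<close> can be chosen to make \<open>g' s w = r (1 - v r)\<close> nilpotent.\<close>

lemma semi_homotopic_if_powers_stabilize:
  assumes t: "E_triangle C X f Y g Z \<delta>" and t': "E_triangle C X' f' Y' g' Z (push C Z \<alpha> \<delta>)"
    and \<alpha>: "arr \<alpha> X X'" and \<beta>: "arr \<beta> Y Y'" and \<beta>f: "\<beta> \<cdot> f = f' \<cdot> \<alpha>" and g'\<beta>: "g' \<cdot> \<beta> = g"
    and stab: "\<And>r. arr r Z Z \<Longrightarrow> \<exists>(m::nat) v. arr v Z Z \<and> r \<cdot> v = v \<cdot> r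
        \<and> r [^]\<^bsub>endo C Z\<^esub> m = r [^]\<^bsub>endo C Z\<^esub> Suc m \<cdot> v"
  shows "semi_homotopic C X f Y X' f' Y' \<alpha> \<beta>"
proof -
  note a = triangleD[OF t] and a' = triangleD[OF t']
  have o: "X \<in> Obj C" "Y \<in> Obj C" "Z \<in> Obj C" "X' \<in> Obj C" "Y' \<in> Obj C"
    using \<alpha> a a' by (auto simp: arr_def)
  define l where "l = \<ominus>\<^bsub>Hom C X' Y'\<^esub> f'"
  have l: "arr l X' Y'" unfolding l_def using arr_uminus[OF a'(1)] .
  have g'l: "g' \<cdot> l = \<zero>\<^bsub>Hom C X' Z\<^esub>"
    unfolding l_def comp_uminus[OF a'(2,1)] deflation_inflation[OF t']
    using abelian_group.uminus_zero Hom_abelian_group[OF o(4,3)] by blast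
  obtain \<beta>0 where \<beta>0: "arr \<beta>0 Y Y'" "\<beta>0 \<cdot> f = f' \<cdot> \<alpha>" "g' \<cdot> \<beta>0 = g"
      and t0: "E_triangle C X (col C X Y X' f \<alpha>) (Y \<boxplus> X') (row C Y X' Y' \<beta>0 l) Y' (pull C X g' \<delta>)"
    using homotopy_pullback[OF t t' \<alpha>] unfolding l_def by blast
  define d where "d = \<beta>0 \<ominus>\<^bsub>Hom C Y Y'\<^esub> \<beta>"
  have d: "arr d Y Y'" unfolding d_def using arr_diff[OF \<beta>0(1) \<beta>] .
  have "d \<cdot> f = \<zero>\<^bsub>Hom C X Y'\<^esub>"
    unfolding d_def diff_comp[OF \<beta>0(1) \<beta> a(1)] \<beta>0(2) \<beta>f hom_diff_self[OF arr_comp[OF a'(1) \<alpha>]] ..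
  then obtain s where s: "arr s Z Y'" "d = s \<cdot> g" using factor_through_deflation[OF t d] by blast
  define r where "r = g' \<cdot> s"
  have r: "arr r Z Z" unfolding r_def using arr_comp[OF a'(2) s(1)] .
  have rg: "r \<cdot> g = \<zero>\<^bsub>Hom C Y Z\<^esub>"
    unfolding r_def comp_assoc[OF a'(2) s(1) a(2)] s(2)[symmetric]
    unfolding d_def comp_diff[OF a'(2) \<beta>0(1) \<beta>] \<beta>0(3) g'\<beta> hom_diff_self[OF a(2)] ..
  interpret R: ring "endo C Z" by (rule endo_ring[OF o(3)])
  interpret S: ring "endo C Y'" by (rule endo_ring[OF o(5)])
  obtain m :: nat and v where v: "arr v Z Z" "r \<cdot> v = v \<cdot> r"
      "r [^]\<^bsub>endo C Z\<^esub> m = r [^]\<^bsub>endo C Z\<^esub> Suc m \<cdot> v"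
    using stab[OF r] by blast
  note iZ = arr_id[OF o(3)] and vr = arr_comp[OF v(1) r]
  define w where "w = Ident C Z \<ominus>\<^bsub>Hom C Z Z\<^esub> v \<cdot> r"
  have w: "arr w Z Z" unfolding w_def using arr_diff[OF iZ vr] .
  have wg: "w \<cdot> g = g"
    unfolding w_def diff_comp[OF iZ vr a(2)] comp_assoc[OF v(1) r a(2)] rg comp_zero[OF o(2) v(1)]
      id_comp[OF a(2)] hom_diff_zero[OF a(2)] ..
  define N where "N = r \<cdot> w"
  have N: "arr N Z Z" unfolding N_def using arr_comp[OF r w] .
  have nil: "N [^]\<^bsub>endo C Z\<^esub> Suc m = \<zero>\<^bsub>Hom C Z Z\<^esub>"
    using R.nilpotent_correction[unfolded endo_simps, OF arrD(1)[OF r] arrD(1)[OF v(1)] v(2,3)]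
    unfolding N_def w_def .
  define s' where "s' = s \<cdot> w"
  have s': "arr s' Z Y'" unfolding s'_def using arr_comp[OF s(1) w] .
  have s'g: "s' \<cdot> g = d" unfolding s'_def comp_assoc[OF s(1) w a(2)] wg s(2) ..
  have g's': "g' \<cdot> s' = N" unfolding s'_def N_def r_def comp_assoc[OF a'(2) s(1) w] ..
  note sg = arr_comp[OF s' a'(2)]
  have pow: "arr (N [^]\<^bsub>endo C Z\<^esub> n) Z Z" for n :: nat
    using R.nat_pow_closed[of N n] arrD(1)[OF N] o by (simp add: arr_def)
  have "(s' \<cdot> g') [^]\<^bsub>endo C Y'\<^esub> Suc n = s' \<cdot> (N [^]\<^bsub>endo C Z\<^esub> n \<cdot> g')" for n :: nat
  proof (induction n)
    case 0
    then show ?case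
      using arrD(1)[OF sg] S.l_one[of "s' \<cdot> g'"] id_comp[OF a'(2)] by simp
  next
    case (Suc n)
    note ng = arr_comp[OF pow[of n] a'(2)]
    have "(s' \<cdot> g') [^]\<^bsub>endo C Y'\<^esub> Suc (Suc n) = (s' \<cdot> (N [^]\<^bsub>endo C Z\<^esub> n \<cdot> g')) \<cdot> (s' \<cdot> g')"
      using Suc S.nat_pow_Suc[of "s' \<cdot> g'" "Suc n"] by simp
    also have "\<dots> = s' \<cdot> ((N [^]\<^bsub>endo C Z\<^esub> n \<cdot> N) \<cdot> g')"
      unfolding comp_assoc[OF s' ng sg] comp_assoc[OF pow a'(2) sg]
        comp_assoc[OF a'(2) s' a'(2), symmetric] g's' comp_assoc[OF pow N a'(2)] ..
    finally show ?case using R.nat_pow_Suc[of N n] by simp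
  qed
  from this[of "Suc m"] have "(s' \<cdot> g') [^]\<^bsub>endo C Y'\<^esub> Suc (Suc m) = \<zero>\<^bsub>Hom C Y' Y'\<^esub>"
    unfolding nil zero_comp[OF o(3) a'(2)] comp_zero[OF o(5) s'] .
  then obtain c' where c': "is_mor C c' Y' Y'" "(Ident C Y' \<ominus>\<^bsub>Hom C Y' Y'\<^esub> s' \<cdot> g') \<cdot> c' = Ident C Y'"
      "c' \<cdot> (Ident C Y' \<ominus>\<^bsub>Hom C Y' Y'\<^esub> s' \<cdot> g') = Ident C Y'"
    by (rule S.one_minus_nilpotent_invertible[unfolded endo_simps, OF arrD(1)[OF sg]])
  define c where "c = Ident C Y' \<ominus>\<^bsub>Hom C Y' Y'\<^esub> s' \<cdot> g'"
  note iY' = arr_id[OF o(5)]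
  have c: "arr c Y' Y'" unfolding c_def using arr_diff[OF iY' sg] .
  have iso: "is_iso C c Y' Y'" 
    unfolding is_iso_def using arrD(1)[OF c] c' unfolding c_def by blast
  have c\<beta>0: "c \<cdot> \<beta>0 = \<beta>"
    unfolding c_def diff_comp[OF iY' sg \<beta>0(1)] comp_assoc[OF s' a'(2) \<beta>0(1)] \<beta>0(3) s'g id_comp[OF \<beta>0(1)]
    unfolding d_def hom_diff_diff_cancel[OF \<beta> \<beta>0(1)] ..
  have cl: "c \<cdot> l = l"
    unfolding c_def diff_comp[OF iY' sg l] comp_assoc[OF s' a'(2) l] g'l comp_zero[OF o(4) s'] id_comp[OF l]
      hom_diff_zero[OF l] ..
  note b = arr_bip[OF o(2,4)] and p = row_simps[OF \<beta> l] and p0 = row_simps[OF \<beta>0(1) l]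
  have "c \<cdot> row C Y X' Y' \<beta>0 l = row C Y X' Y' \<beta> l"
    using comp_assoc[OF c p0(1) b(1)] comp_assoc[OF c p0(1) b(2)] p(2,3) p0(2,3) c\<beta>0 cl
    by (intro eq_on_bip[OF arr_comp[OF c p0(1)] p(1) o(2,4)]) simp_all
  then obtain \<eta>' where \<eta>': "E_triangle C X (col C X Y X' f \<alpha>) (Y \<boxplus> X') (row C Y X' Y' \<beta> l) Y' \<eta>'"
    using triangle_iso_end[OF t0 iso o(5)] by auto
  then show ?thesis
    using extnD(1)[OF triangleD(3)[OF \<eta>']] unfolding semi_homotopic_def l_def by blast
qed

end

theorem theorem1p2:
  fixes C :: "('o, 'm, 'e) extri_cat"
    and K :: "'k ring" and scal :: "'k \<Rightarrow> 'm \<Rightarrow> 'm"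
    and X Y Z X' Y' :: 'o and f g f' g' \<alpha> \<beta> :: 'm and \<delta> :: 'e
  defines "i \<equiv> col C X Y X' f \<alpha>"
    and "p \<equiv> row C Y X' Y' \<beta> (\<ominus>\<^bsub>Hom C X' Y'\<^esub> f')"
    and "\<eta> \<equiv> pull C X g' \<delta>"
  assumes "extriangulated_category C"
    and "E_triangle_morphism C X f Y g Z \<delta> X' f' Y' g' Z (push C Z \<alpha> \<delta>) \<alpha> \<beta> (Ident C Z)"
  shows
    "(\<forall>T\<in>Obj C. exact_six
        (Hom C Y' T) (\<lambda>\<psi>. \<psi> \<cdot>\<^bsub>C\<^esub> p)
        (Hom C (Y \<boxplus>\<^bsub>C\<^esub> X') T) (\<lambda>\<psi>. \<psi> \<cdot>\<^bsub>C\<^esub> i)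
        (Hom C X T) (\<lambda>\<psi>. push C Y' \<psi> \<eta>)
        (Ext C Y' T) (pull C T p)
        (Ext C (Y \<boxplus>\<^bsub>C\<^esub> X') T) (pull C T i)
        (Ext C X T))
     \<and> (semi_homotopic C X f Y X' f' Y' \<alpha> \<beta> \<longrightarrow>
         (\<forall>T\<in>Obj C. exact_six
            (Hom C T X) (\<lambda>\<phi>. i \<cdot>\<^bsub>C\<^esub> \<phi>)
            (Hom C T (Y \<boxplus>\<^bsub>C\<^esub> X')) (\<lambda>\<phi>. p \<cdot>\<^bsub>C\<^esub> \<phi>)
            (Hom C T Y') (\<lambda>\<phi>. pull C X \<phi> \<eta>)
            (Ext C T X) (push C T i)
            (Ext C T (Y \<boxplus>\<^bsub>C\<^esub> X')) (push C T p)
            (Ext C T Y')))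
     \<and> (linear_category C K scal \<and> hom_finite C K scal \<longrightarrow>
         semi_homotopic C X f Y X' f' Y' \<alpha> \<beta>)"
proof -
  interpret extriangulated_category C by fact
  have t: "E_triangle C X f Y g Z \<delta>" and t': "E_triangle C X' f' Y' g' Z (push C Z \<alpha> \<delta>)"
    using assms(5) by (auto simp: E_triangle_morphism_def)
  note a = triangleD[OF t] and a' = triangleD[OF t']
  have o: "X \<in> Obj C" "Y \<in> Obj C" "Z \<in> Obj C" "X' \<in> Obj C" "Y' \<in> Obj C"
    using a a' by (auto simp: arr_def)
  have \<alpha>: "arr \<alpha> X X'" and \<beta>: "arr \<beta> Y Y'" and \<beta>f: "\<beta> \<cdot>\<^bsub>C\<^esub> f = f' \<cdot>\<^bsub>C\<^esub> \<alpha>" and g'\<beta>: "g' \<cdot>\<^bsub>C\<^esub> \<beta> = g"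
    using assms(5) o id_comp[OF a(2)] by (auto simp: E_triangle_morphism_def arr_def)
  note setting = t t' \<alpha> \<beta> \<beta>f g'\<beta>
  have "semi_homotopic C X f Y X' f' Y' \<alpha> \<beta>" if lin: "linear_category C K scal" and fin: "hom_finite C K scal"
  proof (rule semi_homotopic_if_powers_stabilize[OF setting])
    fix r assume r: "arr r Z Z"
    obtain m :: nat and v where "is_mor C v Z Z" "r \<cdot>\<^bsub>C\<^esub> v = v \<cdot>\<^bsub>C\<^esub> r"
        "r [^]\<^bsub>endo C Z\<^esub> m = r [^]\<^bsub>endo C Z\<^esub> Suc m \<cdot>\<^bsub>C\<^esub> v"
      using linear_category.endomorphism_power_stabilizes[OF lin fin o(3) arrD(1)[OF r]] .
    then show "\<exists>(m::nat) v. arr v Z Z \<and> r \<cdot>\<^bsub>C\<^esub> v = v \<cdot>\<^bsub>C\<^esub> r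
        \<and> r [^]\<^bsub>endo C Z\<^esub> m = r [^]\<^bsub>endo C Z\<^esub> Suc m \<cdot>\<^bsub>C\<^esub> v"
      using o(3) by (auto simp: arr_def)
  qed
  moreover have "exact_six
      (Hom C T X) (\<lambda>\<phi>. i \<cdot>\<^bsub>C\<^esub> \<phi>) (Hom C T (Y \<boxplus>\<^bsub>C\<^esub> X')) (\<lambda>\<phi>. p \<cdot>\<^bsub>C\<^esub> \<phi>)
      (Hom C T Y') (\<lambda>\<phi>. pull C X \<phi> \<eta>) (Ext C T X) (push C T i)
      (Ext C T (Y \<boxplus>\<^bsub>C\<^esub> X')) (push C T p) (Ext C T Y')"
    if sh: "semi_homotopic C X f Y X' f' Y' \<alpha> \<beta>" and T: "T \<in> Obj C" for T
  proof -
    obtain \<eta>' where "E_triangle C X i (Y \<boxplus>\<^bsub>C\<^esub> X') p Y' \<eta>'"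
      using sh unfolding semi_homotopic_def i_def p_def by blast
    then show ?thesis
      unfolding i_def p_def \<eta>_def by (rule covariant_sequence_exact[OF setting _ T])
  qed
  moreover have "exact_six
      (Hom C Y' T) (\<lambda>\<psi>. \<psi> \<cdot>\<^bsub>C\<^esub> p) (Hom C (Y \<boxplus>\<^bsub>C\<^esub> X') T) (\<lambda>\<psi>. \<psi> \<cdot>\<^bsub>C\<^esub> i)
      (Hom C X T) (\<lambda>\<psi>. push C Y' \<psi> \<eta>) (Ext C Y' T) (pull C T p)
      (Ext C (Y \<boxplus>\<^bsub>C\<^esub> X') T) (pull C T i) (Ext C X T)"
    if "T \<in> Obj C" for T
    unfolding i_def p_def \<eta>_def by (rule contravariant_sequence_exact[OF setting that])
  ultimately show ?thesis by blast
qed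

end
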